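(* Let $E$ be a compact Polish space and let $I \subseteq \mathcal{K}(E)$ be a $G_{\delta}$ ideal of compact sets with property $( * )$. Then there exists a compact set $\mathcal{F} \subseteq \mathcal{K}(E)$ such that any $G_{\delta}$ subset $G$ of $E$ is covered by countably many sets in $I$ if and only if $G^*$ is meager in $\mathcal{F}$. Further, if $I$ contains only meager sets, then there exists a compact set $\mathcal{F} \subseteq \mathcal{K}(E)$ which is upward closed and such that any $G_{\delta}$ subset $G$ of $E$ is covered by countably many sets in $I$ if and only if $G^*$ is meager in $\mathcal{F}$.
   Context: $\mathcal{K}(E)$ is the hyperspace of compact subsets of $E$ with the Vietoris topology. An ideal of compact sets is a nonempty family closed under taking compact subsets and finite unions. A family $I \subseteq \mathcal{K}(E)$ has property $( * )$ if for any sequence $(K_n) \subseteq I$ there is a $G_{\delta}$ set $G \supseteq \bigcup_n K_n$ with $\mathcal{K}(G) \subseteq I$. For $A \subseteq E$, $A^* = \{K \in \mathcal{K}(E): K \cap A \neq \emptyset\}$. "$A^*$ is meager in $\mathcal{F}$" means $A^* \cap \mathcal{F}$ is relatively meager in $\mathcal{F}$. $\mathcal{F}$ is upward closed if it contains all compact supersets of its members. *)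

theory Defs
  imports "HOL-Analysis.Analysis"
begin

definition polish_in :: "'a topology \<Rightarrow> bool" where
  "polish_in X \<longleftrightarrow> completely_metrizable_space X \<and> separable_space X"

definition nowhere_dense_in :: "'a topology \<Rightarrow> 'a set \<Rightarrow> bool" where
  "nowhere_dense_in X A \<longleftrightarrow> A \<subseteq> topspace X \<and> X interior_of (X closure_of A) = {}"

definition meager_in :: "'a topology \<Rightarrow> 'a set \<Rightarrow> bool" where
  "meager_in X A \<longleftrightarrow> (\<exists>\<N>. countable \<N> \<and> (\<forall>N\<in>\<N>. nowhere_dense_in X N) \<and> A = \<Union>\<N>)"

text \<open>The empty set is a point of the hyperspace (an isolated one in the Vietoris topology).\<close>

definition compacts :: "'a topology \<Rightarrow> 'a set set" where
  "compacts E = {K. compactin E K}"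

definition vietoris :: "'a topology \<Rightarrow> 'a set topology" where
  "vietoris E = topology_generated_by
     ({{K \<in> compacts E. K \<subseteq> U} | U. openin E U} \<union>
      {{K \<in> compacts E. K \<inter> U \<noteq> {}} | U. openin E U})"

lemma topspace_vietoris: "topspace (vietoris E) = compacts E"
proof -
  have "\<And>K. K \<in> compacts E \<Longrightarrow> K \<subseteq> topspace E"
    by (simp add: compacts_def compactin_subset_topspace)
  then show ?thesis
    unfolding vietoris_def topology_generated_by_topspace
    by (auto intro!: exI[of _ "{K \<in> compacts E. K \<subseteq> topspace E}"] exI[of _ "topspace E"])
qed

definition compact_ideal :: "'a topology \<Rightarrow> 'a set set \<Rightarrow> bool" where
  "compact_ideal E I \<longleftrightarrow>
     I \<subseteq> compacts E \<and> I \<noteq> {} \<and>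
     (\<forall>K\<in>I. \<forall>L\<in>compacts E. L \<subseteq> K \<longrightarrow> L \<in> I) \<and>
     (\<forall>\<C>. finite \<C> \<and> \<C> \<subseteq> I \<longrightarrow> \<Union>\<C> \<in> I)"

text \<open>Property \<open>(*)\<close>. For a subset \<open>G\<close> of \<open>E\<close>, the compact subsets of the subspace \<open>G\<close> are the
  compact subsets of \<open>E\<close> contained in \<open>G\<close>.\<close>

definition property_star :: "'a topology \<Rightarrow> 'a set set \<Rightarrow> bool" where
  "property_star E I \<longleftrightarrow>
     (\<forall>K :: nat \<Rightarrow> 'a set. range K \<subseteq> I \<longrightarrow>
        (\<exists>G. gdelta_in E G \<and> (\<Union>n. K n) \<subseteq> G \<and> compacts (subtopology E G) \<subseteq> I))"

definition hits :: "'a topology \<Rightarrow> 'a set \<Rightarrow> 'a set set" where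
  "hits E A = {K \<in> compacts E. K \<inter> A \<noteq> {}}"

text \<open>Meagerness relative to a subspace \<open>F\<close> of the hyperspace.\<close>

definition hits_meager_in :: "'a topology \<Rightarrow> 'a set set \<Rightarrow> 'a set \<Rightarrow> bool" where
  "hits_meager_in E F A \<longleftrightarrow> meager_in (subtopology (vietoris E) F) (hits E A \<inter> F)"

definition upward_closed :: "'a topology \<Rightarrow> 'a set set \<Rightarrow> bool" where
  "upward_closed E F \<longleftrightarrow> (\<forall>K\<in>F. \<forall>L\<in>compacts E. K \<subseteq> L \<longrightarrow> L \<in> F)"

definition countably_covered_by :: "'a set set \<Rightarrow> 'a set \<Rightarrow> bool" where
  "countably_covered_by I A \<longleftrightarrow> (\<exists>\<C>. countable \<C> \<and> \<C> \<subseteq> I \<and> A \<subseteq> \<Union>\<C>)"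

end

theory Submission
  imports Defs
begin

text \<open>Let \<open>I\<close> consist of sets that are nowhere dense in a closed set \<open>S\<close>; the general case reduces
  to this by deleting from \<open>E\<close> all open sets covered by countably many members of \<open>I\<close>. By property
  \<open>(*)\<close> and Baire category the compact sets outside \<open>I\<close> are the union of countably many closed, upward
  closed families \<open>h n\<close>, each stable under removing an open set whose trace lies in \<open>I\<close>. If some
  nonempty closed \<open>X \<subseteq> S\<close> has no relatively open piece inside a member of \<open>I\<close> but a dense set of
  points with singletons in \<open>I\<close>, one constructs closed markers \<open>W n \<subseteq> X\<close> and takes as \<open>F\<close> the
  compact \<open>L \<subseteq> S\<close> that meet \<open>X\<close> and, for every \<open>n\<close>, meet \<open>W n\<close> or all members of \<open>h n\<close>. Stability of
  \<open>h n\<close> makes \<open>K\<^sup>*\<close> nowhere dense in \<open>F\<close> for \<open>K \<in> I\<close>; avoiding a single marker \<open>W n\<close> forces \<open>L\<close> to meet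
  every member of \<open>h n\<close>, so that \<open>K\<^sup>*\<close> has interior in \<open>F\<close>, and does so inside any given open set that
  allows it, for \<open>K \<notin> I\<close>. If there is no such \<open>X\<close>, only the points with singletons outside \<open>I\<close> matter,
  and a convergent sequence of such points provides the markers.\<close>

section \<open>Meagerness relative to a closed set\<close>

text \<open>To require outright that members of \<open>F\<close> meet all sets of
  \<open>h n\<close>, for every \<open>n\<close> at once, would leave no room to shrink a member
  into a small open set or to move it off a set of \<open>I\<close>. The markers are escape clauses.
  A small relatively open piece of \<open>X\<close> meets \<open>W n\<close> for all large
  \<open>n\<close>, so near any prescribed place only finitely many requirements remain, and each of
  these is met separately by goodness of \<open>h n\<close>. Conversely, the requirement for
  \<open>n\<close> is active on the open set of members that miss \<open>W n\<close>. For this set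
  to be nonempty inside a given box, \<open>W n\<close> must be small, which is guaranteed only for
  large \<open>n\<close>. Hence each family has to recur infinitely often, and in localised
  versions, so that its requirement can be met inside a given open set. Smallness means that adding
  \<open>W n\<close> to a closed set outside \<open>h l\<close> eventually leaves it outside.
  Members of \<open>I\<close> have this property, and so the markers are small neighbourhoods in
  \<open>X\<close> of finite sets of points whose singletons lie in \<open>I\<close>.\<close>

definition thin_in :: "'a topology \<Rightarrow> 'a set \<Rightarrow> 'a set \<Rightarrow> bool" where
  "thin_in Z F N \<longleftrightarrow> closedin Z N \<and> (\<forall>W. openin Z W \<longrightarrow> W \<inter> F \<noteq> {} \<longrightarrow> \<not> W \<inter> F \<subseteq> N)"

text \<open>A thin set need not lie in \<open>F\<close>; only its trace on \<open>F\<close> is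
  nowhere dense there, so a set such as \<open>hits E K\<close> can be used as it is. Closures of
  nowhere dense pieces are thin because \<open>F\<close> is closed in \<open>Z\<close>. Conversely a
  thin cover is intersected with \<open>A\<close>, which gives the exact union that
  \<open>meager_in\<close> asks for.\<close>

lemma meager_in_subtopology_iff:
  assumes F: "closedin Z F" and A: "A \<subseteq> F"
  shows "meager_in (subtopology Z F) A \<longleftrightarrow>
    (\<exists>\<N>. countable \<N> \<and> (\<forall>N\<in>\<N>. thin_in Z F N) \<and> A \<subseteq> \<Union>\<N>)"
proof
  assume "meager_in (subtopology Z F) A"
  then obtain \<M> where \<M>: "countable \<M>" "\<forall>N\<in>\<M>. nowhere_dense_in (subtopology Z F) N" "A = \<Union>\<M>"
    unfolding meager_in_def by blast
  define c where "c = (\<lambda>N. subtopology Z F closure_of N)"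
  have "thin_in Z F (c N)" if N: "N \<in> \<M>" for N
  proof -
    have int: "subtopology Z F interior_of c N = {}"
      using \<M>(2) N unfolding nowhere_dense_in_def c_def by blast
    have "closedin Z (c N)"
      unfolding c_def using F closedin_trans_full closedin_closure_of by blast
    moreover have "\<not> W \<inter> F \<subseteq> c N" if W: "openin Z W" "W \<inter> F \<noteq> {}" for W
    proof
      assume "W \<inter> F \<subseteq> c N"
      moreover have "openin (subtopology Z F) (W \<inter> F)"
        using W(1) by (auto simp: openin_subtopology)
      ultimately have "W \<inter> F \<subseteq> subtopology Z F interior_of c N"
        by (simp add: interior_of_maximal)
      then show False using int W(2) by auto
    qed
    ultimately show ?thesis unfolding thin_in_def by blast
  qed
  moreover have "N \<subseteq> c N" if "N \<in> \<M>" for N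
    using \<M>(2) that unfolding c_def nowhere_dense_in_def by (simp add: closure_of_subset)
  ultimately show "\<exists>\<N>. countable \<N> \<and> (\<forall>N\<in>\<N>. thin_in Z F N) \<and> A \<subseteq> \<Union>\<N>"
    using \<M> by (intro exI[of _ "c ` \<M>"]) blast
next
  have top: "topspace (subtopology Z F) = F"
    using F by (metis closedin_subset inf.absorb2 topspace_subtopology)
  assume "\<exists>\<N>. countable \<N> \<and> (\<forall>N\<in>\<N>. thin_in Z F N) \<and> A \<subseteq> \<Union>\<N>"
  then obtain \<N> where \<N>: "countable \<N>" "\<forall>N\<in>\<N>. thin_in Z F N" "A \<subseteq> \<Union>\<N>"
    by blast
  have "nowhere_dense_in (subtopology Z F) (A \<inter> N)" if N: "N \<in> \<N>" for N
  proof -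
    have tN: "closedin Z N" "\<And>W. openin Z W \<Longrightarrow> W \<inter> F \<noteq> {} \<Longrightarrow> \<not> W \<inter> F \<subseteq> N"
      using \<N>(2) N unfolding thin_in_def by auto
    have "closedin (subtopology Z F) (F \<inter> N)"
      using tN(1) closedin_subtopology by blast
    then have cl: "subtopology Z F closure_of (A \<inter> N) \<subseteq> F \<inter> N"
      using A by (meson closure_of_minimal inf_mono order_refl)
    have "subtopology Z F interior_of (subtopology Z F closure_of (A \<inter> N)) = {}"
    proof (rule ccontr)
      assume ne: "subtopology Z F interior_of (subtopology Z F closure_of (A \<inter> N)) \<noteq> {}"
      obtain W where W: "openin Z W"
        "subtopology Z F interior_of (subtopology Z F closure_of (A \<inter> N)) = W \<inter> F"
        using openin_interior_of[of "subtopology Z F"] by (metis openin_subtopology)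
      have "W \<inter> F \<subseteq> N"
        using cl interior_of_subset W(2) by (metis le_inf_iff subset_trans)
      then show False using tN(2) W ne by auto
    qed
    then show ?thesis
      unfolding nowhere_dense_in_def top using A by auto
  qed
  then show "meager_in (subtopology Z F) A"
    unfolding meager_in_def using \<N>
    by (intro exI[of _ "(\<lambda>N. A \<inter> N) ` \<N>"]) auto
qed

text \<open>An open part of the compact Hausdorff subspace \<open>F\<close> is locally compact and
  regular, hence a Baire space; compactness plays the part of a complete metric on the hyperspace.
  The result is applied both to the hyperspace and to \<open>E\<close> itself.\<close>

lemma Baire_closed_cover:
  assumes Z: "compact_space Z" "Hausdorff_space Z" and F: "closedin Z F"
    and W: "openin Z W" "W \<inter> F \<noteq> {}"
    and \<N>: "countable \<N>" "\<And>N. N \<in> \<N> \<Longrightarrow> closedin Z N" "W \<inter> F \<subseteq> \<Union>\<N>"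
  obtains N V where "N \<in> \<N>" "openin Z V" "V \<subseteq> W" "V \<inter> F \<noteq> {}" "V \<inter> F \<subseteq> N"
proof -
  let ?X = "subtopology (subtopology Z F) (W \<inter> F)"
  have X_eq: "?X = subtopology Z (W \<inter> F)"
    by (simp add: subtopology_subtopology inf.absorb2)
  have top: "topspace ?X = W \<inter> F"
    using F closedin_subset by (fastforce simp: X_eq)
  have reg: "regular_space Z"
    using Z compact_Hausdorff_imp_regular_space by blast
  have "locally_compact_space (subtopology Z F)"
    using F Z(1) closedin_compact_space compact_imp_locally_compact_space compact_space_subtopology
    by blast
  moreover have "openin (subtopology Z F) (W \<inter> F)"
    using W(1) by (auto simp: openin_subtopology)
  ultimately have lc: "locally_compact_space ?X" "regular_space ?X"
    using reg by (auto intro!: locally_compact_space_open_subset regular_space_subtopology)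
  have "\<exists>N\<in>\<N>. ?X interior_of (N \<inter> (W \<inter> F)) \<noteq> {}"
  proof (rule ccontr)
    assume "\<not> ?thesis"
    then have "?X interior_of \<Union>((\<lambda>N. N \<inter> (W \<inter> F)) ` \<N>) = {}"
      using \<N> lc by (intro Baire_category_alt) (auto simp: X_eq closedin_subtopology)
    moreover have "\<Union>((\<lambda>N. N \<inter> (W \<inter> F)) ` \<N>) = topspace ?X"
      using \<N>(3) top by auto
    ultimately show False using W(2) top by (metis interior_of_topspace)
  qed
  then obtain N where N: "N \<in> \<N>" "?X interior_of (N \<inter> (W \<inter> F)) \<noteq> {}" by blast
  obtain V where V: "openin Z V" "?X interior_of (N \<inter> (W \<inter> F)) = V \<inter> (W \<inter> F)"
    using openin_interior_of[of ?X] by (metis X_eq openin_subtopology)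
  have "V \<inter> (W \<inter> F) \<subseteq> N \<inter> (W \<inter> F)"
    using V(2) interior_of_subset by metis
  then show thesis
    using that[of N "V \<inter> W"] N V W(1) by (auto simp: Int_assoc)
qed

section \<open>The Vietoris topology\<close>

text \<open>For open \<open>U\<close> and a finite family \<open>\<U>\<close> of open sets this is a
  basic open set of the Vietoris topology. The members of \<open>\<U>\<close> may stick out of
  \<open>U\<close>, and they need not cover \<open>K\<close>.\<close>

definition vbox :: "'a topology \<Rightarrow> 'a set \<Rightarrow> 'a set set \<Rightarrow> 'a set set" where
  "vbox E U \<U> = {K \<in> compacts E. K \<subseteq> U \<and> (\<forall>V\<in>\<U>. K \<inter> V \<noteq> {})}"

lemma openin_vietoris_subset: "openin E U \<Longrightarrow> openin (vietoris E) {K \<in> compacts E. K \<subseteq> U}"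
  unfolding vietoris_def by (rule topology_generated_by_Basis) blast

lemma openin_vietoris_hits: "openin E U \<Longrightarrow> openin (vietoris E) {K \<in> compacts E. K \<inter> U \<noteq> {}}"
  unfolding vietoris_def by (rule topology_generated_by_Basis) blast

lemma openin_vbox:
  assumes "openin E U" "finite \<U>" "\<And>V. V \<in> \<U> \<Longrightarrow> openin E V"
  shows "openin (vietoris E) (vbox E U \<U>)"
  using assms(2,3)
proof (induction rule: finite_induct)
  case empty
  then show ?case using openin_vietoris_subset[OF assms(1)] by (simp add: vbox_def)
next
  case (insert V \<U>)
  have "vbox E U (insert V \<U>) = vbox E U \<U> \<inter> {K \<in> compacts E. K \<inter> V \<noteq> {}}"
    by (auto simp: vbox_def)
  then show ?case using insert by (simp add: openin_Int openin_vietoris_hits)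
qed

lemma closedin_vietoris_subset:
  assumes "closedin E C"
  shows "closedin (vietoris E) {K \<in> compacts E. K \<subseteq> C}"
proof -
  have "compacts E - {K \<in> compacts E. K \<subseteq> C} = {K \<in> compacts E. K \<inter> (topspace E - C) \<noteq> {}}"
    by (auto simp: compacts_def dest: compactin_subset_topspace)
  then show ?thesis
    using openin_vietoris_hits[of E "topspace E - C"] assms
    by (auto simp: closedin_def topspace_vietoris)
qed

lemma closedin_vietoris_hits:
  assumes "closedin E C"
  shows "closedin (vietoris E) (hits E C)"
proof -
  have "compacts E - hits E C = {K \<in> compacts E. K \<subseteq> topspace E - C}"
    by (auto simp: hits_def compacts_def dest: compactin_subset_topspace)
  then show ?thesis
    using openin_vietoris_subset[of E "topspace E - C"] assms
    by (auto simp: closedin_def topspace_vietoris hits_def)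
qed

lemma Hausdorff_vietoris:
  assumes E: "compact_space E" "Hausdorff_space E"
  shows "Hausdorff_space (vietoris E)"
proof -
  have sep: "\<exists>U V. openin (vietoris E) U \<and> openin (vietoris E) V \<and> K \<in> U \<and> L \<in> V \<and> disjnt U V"
    if KL: "K \<in> compacts E" "L \<in> compacts E" "x \<in> K" "x \<notin> L" for K L x
  proof -
    have "compactin E {x}" "compactin E L" "disjnt {x} L"
      using KL by (auto simp: compacts_def disjnt_def dest: compactin_subset_topspace)
    then obtain U V where UV: "openin E U" "openin E V" "x \<in> U" "L \<subseteq> V" "disjnt U V"
      by (metis E(2) Hausdorff_space_compact_sets insert_subset)
    have "disjnt {K \<in> compacts E. K \<inter> U \<noteq> {}} {K \<in> compacts E. K \<subseteq> V}"
      using UV(5) by (auto simp: disjnt_iff)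
    then show ?thesis
      using KL UV openin_vietoris_hits[OF UV(1)] openin_vietoris_subset[OF UV(2)] by blast
  qed
  show ?thesis
    unfolding Hausdorff_space_def topspace_vietoris
  proof (intro allI impI, elim conjE)
    fix K L assume KL: "K \<in> compacts E" "L \<in> compacts E" "K \<noteq> L"
    then consider x where "x \<in> K" "x \<notin> L" | x where "x \<in> L" "x \<notin> K" by blast
    then show "\<exists>U V. openin (vietoris E) U \<and> openin (vietoris E) V \<and> K \<in> U \<and> L \<in> V \<and> disjnt U V"
    proof cases
      case 1 then show ?thesis using sep KL by blast
    next
      case 2 then show ?thesis using sep[of L K x] KL by (metis disjnt_sym)
    qed
  qed
qed

text \<open>Alexander's subbase lemma. Delete from \<open>E\<close> every open set whose hit set
  belongs to the cover. The compact remainder \<open>C\<close> lies in none of these hit sets, so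
  the cover contains a containment set for some open \<open>U\<close> around \<open>C\<close>; the
  complement of \<open>U\<close> is compact and covered by finitely many of the deleted sets. An
  empty \<open>C\<close> is no exception, as the empty set is a point of the hyperspace.\<close>

lemma compact_space_vietoris:
  assumes E: "compact_space E" "Hausdorff_space E"
  shows "compact_space (vietoris E)"
proof (rule Alexander_subbase_alt)
  let ?B = "{{K \<in> compacts E. K \<subseteq> U} | U. openin E U} \<union> {{K \<in> compacts E. K \<inter> U \<noteq> {}} | U. openin E U}"
  show "compacts E \<subseteq> \<Union>?B"
    using topspace_vietoris[of E] unfolding vietoris_def topology_generated_by_topspace by simp
  show "topology (arbitrary union_of (finite intersection_of (\<lambda>x. x \<in> ?B) relative_to compacts E)) = vietoris E"
    (is "?T = _")
  proof -
    have "openin ?T = openin (vietoris E)"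
    proof (intro ext iffI)
      fix S assume S: "openin ?T S"
      have c: "openin (vietoris E) (compacts E)"
        using openin_topspace[of "vietoris E"] by (simp add: topspace_vietoris)
      show "openin (vietoris E) S"
        by (rule minimal_topology_subbase[OF _ c S])
          (auto intro: openin_vietoris_subset openin_vietoris_hits)
    next
      fix S assume "openin (vietoris E) S"
      then have "generate_topology_on ?B S"
        unfolding vietoris_def openin_topology_generated_by_iff .
      then show "openin ?T S"
      proof (rule generate_topology_on_coarsest[rotated 2])
        show "istopology (openin ?T)" by simp
        fix V assume V: "V \<in> ?B"
        then have "V = compacts E \<inter> V" by blast
        moreover have "openin ?T (compacts E \<inter> V)"
          unfolding openin_subbase
          by (intro arbitrary_union_of_inc relative_to_inc finite_intersection_of_inc V)
        ultimately show "openin ?T V" by simp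
      qed
    qed
    then show ?thesis by (simp add: topology_eq)
  qed
  fix \<C> assume \<C>: "\<C> \<subseteq> ?B" "compacts E \<subseteq> \<Union>\<C>"
  define \<H> where "\<H> = {U. openin E U \<and> {K \<in> compacts E. K \<inter> U \<noteq> {}} \<in> \<C>}"
  define C where "C = topspace E - \<Union>\<H>"
  have "openin E (\<Union>\<H>)" unfolding \<H>_def by blast
  then have cC: "closedin E C" unfolding C_def by blast
  then have "C \<in> compacts E" using E by (simp add: compacts_def closedin_compact_space)
  then obtain \<U> where \<U>: "\<U> \<in> \<C>" "C \<in> \<U>" using \<C>(2) by blast
  have no: "\<not> (\<exists>U. \<U> = {K \<in> compacts E. K \<inter> U \<noteq> {}} \<and> openin E U)"
    using \<U> unfolding C_def \<H>_def by blast
  have or: "(\<exists>U. \<U> = {K \<in> compacts E. K \<subseteq> U} \<and> openin E U) \<or>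
      (\<exists>U. \<U> = {K \<in> compacts E. K \<inter> U \<noteq> {}} \<and> openin E U)"
    using rev_subsetD[OF \<U>(1) \<C>(1)] by (simp only: Un_iff mem_Collect_eq)
  have "\<exists>U. \<U> = {K \<in> compacts E. K \<subseteq> U} \<and> openin E U"
    by (rule disjE[OF or]) (assumption, rule notE[OF no])
  then obtain U where U: "openin E U" "\<U> = {K \<in> compacts E. K \<subseteq> U}"
    by (elim exE conjE)
  then have CU: "C \<subseteq> U" using \<U> by blast
  have "compactin E (topspace E - U)"
    using E U(1) closedin_compact_space by blast
  moreover have "topspace E - U \<subseteq> \<Union>\<H>" using CU unfolding C_def by blast
  moreover have "\<And>V. V \<in> \<H> \<Longrightarrow> openin E V" unfolding \<H>_def by blast
  ultimately obtain \<F> where \<F>: "finite \<F>" "\<F> \<subseteq> \<H>" "topspace E - U \<subseteq> \<Union>\<F>"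
    by (meson compactinD)
  let ?h = "\<lambda>V. {K \<in> compacts E. K \<inter> V \<noteq> {}}"
  have "compacts E \<subseteq> \<Union>(insert \<U> (?h ` \<F>))"
  proof
    fix K assume K: "K \<in> compacts E"
    then have "K \<subseteq> topspace E" by (simp add: compacts_def compactin_subset_topspace)
    then have "K \<subseteq> U \<or> (\<exists>V\<in>\<F>. K \<inter> V \<noteq> {})" using \<F>(3) by blast
    then show "K \<in> \<Union>(insert \<U> (?h ` \<F>))"
      using K by (auto simp: U(2))
  qed
  moreover have "?h ` \<F> \<subseteq> \<C>" using \<F>(2) unfolding \<H>_def by (auto simp only: subset_iff image_iff mem_Collect_eq)
  ultimately show "\<exists>C'. finite C' \<and> C' \<subseteq> \<C> \<and> compacts E \<subseteq> \<Union>C'"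
    using \<U>(1) \<F>(1) by (intro exI[of _ "insert \<U> (?h ` \<F>)"]) auto
qed

text \<open>The base is rich enough to interpolate between any closed set, not only a point, and an
  open set around it. This yields a countable base of boxes for the hyperspace and codes the
  position of a closed set by one natural number, which keeps all later choices countable.\<close>

locale compact_base =
  fixes E :: "'a topology" and b :: "nat \<Rightarrow> 'a set"
  assumes compact: "compact_space E" and Hausdorff: "Hausdorff_space E"
    and open_b: "openin E (b n)"
    and base: "\<lbrakk>closedin E K; openin E U; K \<subseteq> U\<rbrakk> \<Longrightarrow> \<exists>n. K \<subseteq> b n \<and> E closure_of b n \<subseteq> U"
begin

lemma compacts_iff: "K \<in> compacts E \<longleftrightarrow> closedin E K"
  using compact Hausdorff by (auto simp: compacts_def closedin_compact_space compactin_imp_closedin)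

lemma b_subset_closure: "b n \<subseteq> E closure_of b n"
  using open_b by (simp add: closure_of_subset openin_subset)

lemma closedin_singleton: "x \<in> topspace E \<Longrightarrow> closedin E {x}"
  using Hausdorff by (simp add: closedin_Hausdorff_singleton)

lemma base_point:
  assumes "openin E U" "x \<in> U"
  obtains n where "x \<in> b n" "E closure_of b n \<subseteq> U"
  using base[OF closedin_singleton assms(1)] assms openin_subset by blast

lemma vbox_base:
  assumes "openin (vietoris E) W" "K \<in> W"
  obtains n ns where "K \<in> vbox E (b n) (b ` set ns)" "vbox E (b n) (b ` set ns) \<subseteq> W"
proof -
  have "\<exists>n ns. K \<in> vbox E (b n) (b ` set ns) \<and> vbox E (b n) (b ` set ns) \<subseteq> W"
    using assms(1)[unfolded vietoris_def openin_topology_generated_by_iff] assms(2)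
  proof (induction arbitrary: K rule: generate_topology_on.induct)
    case (Int W1 W2)
    obtain n1 ns1 where 1: "K \<in> vbox E (b n1) (b ` set ns1)" "vbox E (b n1) (b ` set ns1) \<subseteq> W1"
      using Int by blast
    obtain n2 ns2 where 2: "K \<in> vbox E (b n2) (b ` set ns2)" "vbox E (b n2) (b ` set ns2) \<subseteq> W2"
      using Int by blast
    have "closedin E K" "K \<subseteq> b n1 \<inter> b n2" using 1 2 by (auto simp: vbox_def compacts_iff)
    then obtain n where n: "K \<subseteq> b n" "b n \<subseteq> b n1 \<inter> b n2"
      using base open_b b_subset_closure by (meson openin_Int subset_trans)
    have "K \<in> vbox E (b n) (b ` set (ns1 @ ns2))"
      using 1 2 n by (auto simp: vbox_def)
    moreover have "vbox E (b n) (b ` set (ns1 @ ns2)) \<subseteq> W1 \<inter> W2"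
      using n 1(2) 2(2) by (force simp: vbox_def)
    ultimately show ?case by blast
  next
    case (Basis S)
    then consider U where "openin E U" "S = {K \<in> compacts E. K \<subseteq> U}"
      | U where "openin E U" "S = {K \<in> compacts E. K \<inter> U \<noteq> {}}" by blast
    then show ?case
    proof cases
      case 1
      then obtain n where "K \<subseteq> b n" "b n \<subseteq> U"
        using base Basis b_subset_closure compacts_iff
        by (metis (no_types, lifting) mem_Collect_eq subset_trans)
      then show ?thesis using 1 Basis
        by (intro exI[of _ n] exI[of _ "[]"]) (auto simp: vbox_def)
    next
      case 2
      then obtain x where x: "x \<in> K" "x \<in> U" using Basis by blast
      obtain m where "x \<in> b m" "E closure_of b m \<subseteq> U"
        by (rule base_point[OF 2(1) x(2)])
      then have m: "x \<in> b m" "b m \<subseteq> U"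
        using b_subset_closure by (auto intro: subset_trans)
      have "closedin E K" using Basis.prems 2(2) by (simp add: compacts_iff)
      then obtain n where "K \<subseteq> b n"
        using base[of K "topspace E"] closedin_subset by blast
      moreover have "K \<inter> b m \<noteq> {}" "K \<in> compacts E"
        using x m Basis.prems 2(2) by auto
      moreover have "L \<inter> U \<noteq> {}" if "L \<inter> b m \<noteq> {}" for L
        using that m(2) by blast
      ultimately have "K \<in> vbox E (b n) (b ` set [m])" "vbox E (b n) (b ` set [m]) \<subseteq> S"
        unfolding 2(2) by (simp_all add: vbox_def subset_iff)
      then show ?thesis by blast
    qed
  next
    case Empty
    then show ?case by simp
  next
    case (UN \<K>)
    then obtain W where W: "W \<in> \<K>" "K \<in> W" by blast
    show ?case using UN.IH[OF W] W(1) by blast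
  qed
  then show thesis using that by blast
qed

lemma openin_bbox: "openin (vietoris E) (vbox E (b n) (b ` set ns))"
  using open_b by (intro openin_vbox) auto

lemmas Baire_vietoris = Baire_closed_cover[OF
  compact_space_vietoris[OF compact Hausdorff] Hausdorff_vietoris[OF compact Hausdorff]]

end

section \<open>Good families\<close>

locale gdelta_ideal = compact_base E b for E :: "'a topology" and b +
  fixes I :: "'a set set"
  assumes ideal: "compact_ideal E I"
    and gdelta: "gdelta_in (vietoris E) I"
    and star: "property_star E I"
begin

lemma I_closed: "K \<in> I \<Longrightarrow> closedin E K"
  using ideal compacts_iff by (auto simp: compact_ideal_def)

lemma I_subset: "\<lbrakk>K \<in> I; closedin E L; L \<subseteq> K\<rbrakk> \<Longrightarrow> L \<in> I"
  using ideal compacts_iff by (auto simp: compact_ideal_def)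

lemma I_Union: "\<lbrakk>finite \<C>; \<C> \<subseteq> I\<rbrakk> \<Longrightarrow> \<Union>\<C> \<in> I"
  using ideal by (simp add: compact_ideal_def)

lemma I_empty: "{} \<in> I"
  using I_Union[of "{}"] by simp

lemma I_finite:
  assumes "finite T" "\<And>x. x \<in> T \<Longrightarrow> {x} \<in> I"
  shows "T \<in> I"
  using I_Union[of "(\<lambda>x. {x}) ` T"] assms by auto

text \<open>The last condition is what makes \<open>K \<in> I\<close> invisible to the polar of \<open>H\<close>: near a compact set
  meeting every member of \<open>H\<close> there is another one that is disjoint from \<open>K\<close>.\<close>

definition good :: "'a set set \<Rightarrow> bool" where
  "good H \<longleftrightarrow> {} \<notin> H \<and> (\<forall>M\<in>H. closedin E M) \<and>
     (\<forall>M\<in>H. \<forall>L. closedin E L \<longrightarrow> M \<subseteq> L \<longrightarrow> L \<in> H) \<and>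
     (\<forall>C. closedin E C \<longrightarrow> C \<notin> H \<longrightarrow> (\<exists>U. openin E U \<and> C \<subseteq> U \<and> (\<forall>M\<in>H. \<not> M \<subseteq> U))) \<and>
     (\<forall>M\<in>H. \<forall>U. \<forall>K\<in>I. openin E U \<longrightarrow> M \<inter> U \<subseteq> K \<longrightarrow> M - U \<in> H)"

lemma good_empty: "good H \<Longrightarrow> {} \<notin> H"
  unfolding good_def by blast

lemma good_closed: "\<lbrakk>good H; M \<in> H\<rbrakk> \<Longrightarrow> closedin E M"
  by (simp add: good_def)

lemma good_mono:
  assumes "good H" "M \<in> H" "closedin E L" "M \<subseteq> L"
  shows "L \<in> H"
proof -
  have "\<forall>M\<in>H. \<forall>L. closedin E L \<longrightarrow> M \<subseteq> L \<longrightarrow> L \<in> H"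
    using assms(1) unfolding good_def by (elim conjE) assumption
  then show ?thesis using assms(2-4) by simp
qed

lemma good_outside:
  assumes "good H" "closedin E C" "C \<notin> H"
  obtains U where "openin E U" "C \<subseteq> U" "\<And>M. M \<in> H \<Longrightarrow> \<not> M \<subseteq> U"
  using assms unfolding good_def by meson

lemma good_Diff: "\<lbrakk>good H; M \<in> H; K \<in> I; openin E U; M \<inter> U \<subseteq> K\<rbrakk> \<Longrightarrow> M - U \<in> H"
  unfolding good_def by blast

text \<open>\<open>C \<union> K\<close> differs from \<open>C\<close> only inside \<open>K\<close>,
  so removing the open complement of \<open>C\<close> would carry membership in \<open>H\<close>
  back to \<open>C\<close>.\<close>

lemma good_Un:
  assumes "good H" "closedin E C" "C \<notin> H" "K \<in> I"
  shows "C \<union> K \<notin> H"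
proof
  assume "C \<union> K \<in> H"
  moreover have "(C \<union> K) \<inter> (topspace E - C) \<subseteq> K" by blast
  ultimately have "(C \<union> K) - (topspace E - C) \<in> H"
    using good_Diff[OF assms(1) _ assms(4)] assms(2) by blast
  moreover have "(C \<union> K) - (topspace E - C) = C"
    using I_closed[OF assms(4)] assms(2) closedin_subset by blast
  ultimately show False using assms(3) by simp
qed

lemma good_disjoint: "good H \<Longrightarrow> K \<in> I \<Longrightarrow> K \<notin> H"
  using good_Un[of H "{}" K] good_empty by auto

text \<open>This localises a good family: as only the trace on \<open>T\<close> counts, a set
  meeting all members can be sought inside \<open>T\<close>.\<close>

lemma good_restrict:
  assumes H: "good H" and T: "closedin E T"
  shows "good {M. closedin E M \<and> M \<inter> T \<in> H}"
  unfolding good_def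
proof (intro conjI ballI allI impI)
  show "{} \<notin> {M. closedin E M \<and> M \<inter> T \<in> H}"
    using good_empty[OF H] by simp
next
  fix M L assume "M \<in> {M. closedin E M \<and> M \<inter> T \<in> H}" "closedin E L" "M \<subseteq> L"
  then show "L \<in> {M. closedin E M \<and> M \<inter> T \<in> H}"
    using good_mono[OF H, of "M \<inter> T" "L \<inter> T"] T by blast
next
  fix C assume C: "closedin E C" "C \<notin> {M. closedin E M \<and> M \<inter> T \<in> H}"
  then obtain U where U: "openin E U" "C \<inter> T \<subseteq> U" "\<And>M. M \<in> H \<Longrightarrow> \<not> M \<subseteq> U"
    using good_outside[OF H, of "C \<inter> T"] T by blast
  have "C \<subseteq> U \<union> (topspace E - T)" using U(2) closedin_subset[OF C(1)] by blast
  moreover have "openin E (U \<union> (topspace E - T))" using U(1) T by blast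
  moreover have "\<not> M \<subseteq> U \<union> (topspace E - T)" if "M \<in> {M. closedin E M \<and> M \<inter> T \<in> H}" for M
    using U(3)[of "M \<inter> T"] that by blast
  ultimately show "\<exists>U. openin E U \<and> C \<subseteq> U \<and> (\<forall>M\<in>{M. closedin E M \<and> M \<inter> T \<in> H}. \<not> M \<subseteq> U)"
    by blast
next
  fix M U K assume M: "M \<in> {M. closedin E M \<and> M \<inter> T \<in> H}" and K: "K \<in> I"
    and U: "openin E U" "M \<inter> U \<subseteq> K"
  have "M \<inter> T - U \<in> H" using good_Diff[OF H _ K U(1), of "M \<inter> T"] M U(2) by blast
  moreover have "(M - U) \<inter> T = M \<inter> T - U" by blast
  moreover have "closedin E (M - U)" using M U(1) by (simp add: closedin_diff)
  ultimately show "M - U \<in> {M. closedin E M \<and> M \<inter> T \<in> H}" by simp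
qed auto

text \<open>Some open \<open>V\<close> around the forbidden set
  \<open>(topspace E - U) \<union> Q\<close> contains no member of \<open>H\<close>. The trace on
  \<open>S\<close> of a member is again a member, hence sticks out of \<open>V\<close> and meets
  \<open>S - V\<close>.\<close>

lemma good_hitting:
  assumes H: "good H" and S: "closedin E S" "\<And>M. M \<in> H \<Longrightarrow> M \<inter> S \<in> H"
    and U: "openin E U" and Q: "closedin E Q" "(topspace E - U) \<union> Q \<notin> H"
  obtains L where "closedin E L" "L \<subseteq> S \<inter> U - Q" "\<And>M. M \<in> H \<Longrightarrow> L \<inter> M \<noteq> {}"
proof -
  have "closedin E ((topspace E - U) \<union> Q)" using U Q(1) by blast
  then obtain V where V: "openin E V" "(topspace E - U) \<union> Q \<subseteq> V" "\<And>M. M \<in> H \<Longrightarrow> \<not> M \<subseteq> V"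
    using good_outside[OF H _ Q(2)] by blast
  show thesis
  proof (rule that[of "S - V"])
    show "closedin E (S - V)" using S(1) V(1) by (simp add: closedin_diff)
    show "S - V \<subseteq> S \<inter> U - Q" using V(2) closedin_subset[OF S(1)] by blast
    show "(S - V) \<inter> M \<noteq> {}" if "M \<in> H" for M
      using V(3)[OF S(2)[OF that]] by blast
  qed
qed

text \<open>For every \<open>i\<close> choose a countable subfamily of \<open>I\<close> witnessing failure, if there is one, and take
  the union of all choices.\<close>

lemma countable_saturation:
  fixes Q :: "'i::countable \<Rightarrow> 'a set set"
  shows "\<exists>A. countable A \<and> A \<subseteq> I \<and>
    (\<forall>i B. (\<exists>L\<in>Q i. L \<inter> \<Union>A = {}) \<longrightarrow> countable B \<longrightarrow> B \<subseteq> I \<longrightarrow> (\<exists>L\<in>Q i. L \<inter> \<Union>B = {}))"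
proof -
  define bad where "bad i B \<longleftrightarrow> countable B \<and> B \<subseteq> I \<and> \<not> (\<exists>L\<in>Q i. L \<inter> \<Union>B = {})" for i B
  define A0 where "A0 i = (if \<exists>B. bad i B then SOME B. bad i B else {})" for i
  have A0: "bad i (A0 i)" if "bad i B" for i B
    using that someI[of "bad i" B] unfolding A0_def by auto
  have A0': "countable (A0 i) \<and> A0 i \<subseteq> I" for i
  proof (cases "\<exists>B. bad i B")
    case True
    then show ?thesis using A0 bad_def by blast
  next
    case False
    then show ?thesis by (simp add: A0_def)
  qed
  show ?thesis
  proof (intro exI[of _ "\<Union>i. A0 i"] conjI allI impI)
    show "countable (\<Union>i. A0 i)" "(\<Union>i. A0 i) \<subseteq> I" using A0' by auto
    fix i B assume i: "\<exists>L\<in>Q i. L \<inter> \<Union>(\<Union>i. A0 i) = {}" and B: "countable B" "B \<subseteq> I"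
    show "\<exists>L\<in>Q i. L \<inter> \<Union>B = {}"
    proof (rule ccontr)
      assume "\<not> ?thesis"
      then have "bad i (A0 i)" using A0[of i B] B unfolding bad_def by blast
      moreover have "L \<inter> \<Union>(A0 i) \<subseteq> L \<inter> \<Union>(\<Union>i. A0 i)" for L by blast
      ultimately show False using i unfolding bad_def by (metis subset_empty)
    qed
  qed
qed

lemma countable_sub_gdelta:
  assumes "countable A" "A \<subseteq> I"
  obtains C :: "nat \<Rightarrow> 'a set" where "\<And>j. closedin E (C j)" "\<And>j. C j \<inter> \<Union>A = {}"
    "\<And>K. closedin E K \<Longrightarrow> (\<And>j. K \<inter> C j = {}) \<Longrightarrow> K \<in> I"
proof -
  \<comment> \<open>The set \<open>{}\<close>, a member of \<open>I\<close>, is added so that there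
    is something to enumerate when \<open>A\<close> is empty.\<close>
  define k where "k = from_nat_into (insert {} A)"
  have rk: "range k = insert {} A"
    unfolding k_def using assms(1) by (simp add: range_from_nat_into)
  then have "range k \<subseteq> I" using assms(2) I_empty by simp
  then obtain G where G: "gdelta_in E G" "(\<Union>n. k n) \<subseteq> G" "compacts (subtopology E G) \<subseteq> I"
    using star unfolding property_star_def by meson
  have "fsigma_in E (topspace E - G)"
    using G(1) by (simp add: gdelta_in_fsigma_in)
  then obtain C where C: "\<And>n::nat. closedin E (C n)" "\<Union>(range C) = topspace E - G"
    unfolding fsigma_in_ascending by metis
  have AG: "\<Union>A \<subseteq> G" using G(2) rk by auto
  show thesis
  proof (rule that[of C])
    show "closedin E (C j)" for j using C(1) .
    show "C j \<inter> \<Union>A = {}" for j using C(2) AG by blast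
    fix K assume K: "closedin E K" "\<And>j. K \<inter> C j = {}"
    then have "K \<subseteq> G" using C(2) closedin_subset[OF K(1)] by blast
    moreover have "compactin E K" using K(1) compact closedin_compact_space by blast
    ultimately have "K \<in> compacts (subtopology E G)"
      by (simp add: compacts_def compactin_subtopology)
    then show "K \<in> I" using G(3) by blast
  qed
qed

text \<open>The \<open>F_\<sigma>\<close> set supplied by property \<open>(*)\<close> for a saturated countable \<open>A \<subseteq> I\<close> is met by every member of \<open>D\<close>,
  so by the Baire category theorem one of its closed pieces meets every member of an open part of \<open>D\<close>.
  This piece avoids \<open>\<Union>A\<close> and keeps the polar, hence the good family, from being trivial.\<close>

lemma good_local:
  assumes D: "closedin (vietoris E) D" "D \<noteq> {}" "D \<inter> I = {}"
  obtains n ns H where "D \<inter> vbox E (b n) (b ` set ns) \<noteq> {}" "good H"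
    "D \<inter> vbox E (b n) (b ` set ns) \<subseteq> H"
proof -
  define P where "P n ns = {L. closedin E L \<and> (\<forall>M \<in> D \<inter> vbox E (b n) (b ` set ns). L \<inter> M \<noteq> {})}"
    for n ns
  define Q where "Q = (\<lambda>(n, ns, m). {L \<in> P n ns. L \<subseteq> b m})"
  obtain A where A: "countable A" "A \<subseteq> I"
    "\<And>i B. \<lbrakk>\<exists>L\<in>Q i. L \<inter> \<Union>A = {}; countable B; B \<subseteq> I\<rbrakk> \<Longrightarrow> \<exists>L\<in>Q i. L \<inter> \<Union>B = {}"
    using countable_saturation[of Q] by metis
  obtain C where C: "\<And>j::nat. closedin E (C j)" "\<And>j. C j \<inter> \<Union>A = {}"
    "\<And>K. closedin E K \<Longrightarrow> (\<And>j. K \<inter> C j = {}) \<Longrightarrow> K \<in> I"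
    using countable_sub_gdelta[OF A(1,2)] by metis
  have Dc: "D \<subseteq> compacts E" using D(1) closedin_subset topspace_vietoris by metis
  have "D \<subseteq> (\<Union>j. hits E (C j))"
  proof
    fix M assume M: "M \<in> D"
    then have "closedin E M" "M \<notin> I" using Dc compacts_iff D(3) by auto
    then obtain j where "M \<inter> C j \<noteq> {}" using C(3) by blast
    then show "M \<in> (\<Union>j. hits E (C j))" using M Dc by (auto simp: hits_def)
  qed
  moreover have "openin (vietoris E) (compacts E)"
    using openin_topspace[of "vietoris E"] by (simp add: topspace_vietoris)
  moreover have "compacts E \<inter> D = D" using Dc by blast
  moreover have "closedin (vietoris E) N" if "N \<in> range (\<lambda>j. hits E (C j))" for N
    using that C(1) closedin_vietoris_hits by auto
  moreover have "countable (range (\<lambda>j. hits E (C j)))" by simp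
  ultimately obtain N V where N: "N \<in> range (\<lambda>j. hits E (C j))"
      and V: "openin (vietoris E) V" "V \<inter> D \<noteq> {}" "V \<inter> D \<subseteq> N"
    using Baire_vietoris[OF D(1), of "compacts E" "range (\<lambda>j. hits E (C j))"] D(2) by metis
  then obtain j where j: "V \<inter> D \<subseteq> hits E (C j)" by blast
  obtain M where M: "M \<in> V" "M \<in> D" using V(2) by blast
  obtain n ns where box: "M \<in> vbox E (b n) (b ` set ns)" "vbox E (b n) (b ` set ns) \<subseteq> V"
    by (rule vbox_base[OF V(1) M(1)])
  have CP: "C j \<in> P n ns"
    using j box(2) C(1) unfolding P_def hits_def by blast
  \<comment> \<open>A bipolar: \<open>P n ns\<close> is the polar of the box part of
    \<open>D\<close>, and \<open>H\<close> is the polar of those of its elements that miss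
    \<open>\<Union>A\<close>. It contains the box part of \<open>D\<close> automatically, and
    \<open>C j\<close> is one of these elements, so \<open>{}\<close> is not in
    \<open>H\<close>.\<close>
  define H where "H = {M. closedin E M \<and> (\<forall>L\<in>P n ns. L \<inter> \<Union>A = {} \<longrightarrow> M \<inter> L \<noteq> {})}"
  have "good H"
    unfolding good_def
  proof (intro conjI ballI allI impI)
    show "{} \<notin> H" using CP C(2) unfolding H_def by blast
  next
    fix M assume "M \<in> H" then show "closedin E M" unfolding H_def by blast
  next
    fix M L assume M: "M \<in> H" "closedin E L" "M \<subseteq> L"
    have "L \<inter> L' \<noteq> {}" if "L' \<in> P n ns" "L' \<inter> \<Union>A = {}" for L'
    proof -
      have "M \<inter> L' \<noteq> {}" using M(1) that unfolding H_def by simp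
      then show ?thesis using M(3) by blast
    qed
    then show "L \<in> H" using M(2) unfolding H_def by simp
  next
    fix M assume "closedin E M" "M \<notin> H"
    then obtain L where L: "L \<in> P n ns" "L \<inter> \<Union>A = {}" "M \<inter> L = {}"
      unfolding H_def by auto
    have "openin E (topspace E - L)" using L(1) unfolding P_def by blast
    moreover have "M \<subseteq> topspace E - L" using L(3) closedin_subset \<open>closedin E M\<close> by blast
    moreover have "\<not> M \<subseteq> topspace E - L" if "M \<in> H" for M
    proof -
      have "M \<inter> L \<noteq> {}" using that L(1,2) unfolding H_def by simp
      then show ?thesis by blast
    qed
    ultimately show "\<exists>U. openin E U \<and> M \<subseteq> U \<and> (\<forall>M\<in>H. \<not> M \<subseteq> U)" by blast
  next
    fix M U K assume M: "M \<in> H" and K: "K \<in> I" and U: "openin E U" "M \<inter> U \<subseteq> K"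
    have cM: "closedin E M" using M unfolding H_def by blast
    then have cMU: "closedin E (M - U)" using U(1) by (simp add: closedin_diff)
    have "(M - U) \<inter> L \<noteq> {}" if L: "L \<in> P n ns" "L \<inter> \<Union>A = {}" for L
    proof
      assume disj: "(M - U) \<inter> L = {}"
      have "closedin E L" using L(1) unfolding P_def by blast
      moreover have "openin E (topspace E - (M - U))" using cMU by blast
      moreover have "L \<subseteq> topspace E - (M - U)" using disj closedin_subset calculation(1) by blast
      ultimately obtain m where m: "L \<subseteq> b m" "b m \<subseteq> topspace E - (M - U)"
        using base b_subset_closure by (meson subset_trans)
      \<comment> \<open>Saturation replaces \<open>L\<close> by a set \<open>L'\<close> in the same
        \<open>b m\<close> that misses \<open>K\<close> as well as \<open>\<Union>A\<close>. Since
        \<open>b m\<close> avoids \<open>M - U\<close>, the set \<open>M\<close> can meet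
        \<open>L'\<close> only inside \<open>U\<close>, hence only inside \<open>K\<close>, which is
        impossible. For this reason \<open>Q\<close> also records the base set
        \<open>b m\<close>.\<close>
      have "\<exists>L\<in>Q (n, ns, m). L \<inter> \<Union>A = {}" using L m(1) by (intro bexI[of _ L]) (simp_all add: Q_def)
      then have "\<exists>L\<in>Q (n, ns, m). L \<inter> \<Union>(insert K A) = {}"
        using A(3)[of "(n, ns, m)" "insert K A"] A(1,2) K by simp
      then obtain L' where L': "L' \<in> P n ns" "L' \<subseteq> b m" "L' \<inter> \<Union>(insert K A) = {}"
        unfolding Q_def by auto
      have LA: "L' \<inter> \<Union>A = {}" "K \<inter> L' = {}" using L'(3) by (simp_all add: Int_Un_distrib Int_commute)
      have "\<forall>L\<in>P n ns. L \<inter> \<Union>A = {} \<longrightarrow> M \<inter> L \<noteq> {}" using M unfolding H_def by simp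
      then have "M \<inter> L' \<noteq> {}" using L'(1) LA(1) by simp
      moreover have "M \<inter> L' \<subseteq> U" using L'(2) m(2) by blast
      ultimately show False using U(2) LA(2) by blast
    qed
    then show "M - U \<in> H" using cMU unfolding H_def by simp
  qed
  moreover have "D \<inter> vbox E (b n) (b ` set ns) \<subseteq> H"
    using Dc compacts_iff unfolding H_def P_def by auto
  ultimately show thesis using that[of n ns H] M(2) box(1) by blast
qed

text \<open>A Cantor-Bendixson exhaustion: delete all boxes on which \<open>D\<close> is already
  covered by countably many good families. On a nonempty closed remainder \<open>good_local\<close>
  would supply one more such box.\<close>

lemma good_cover_closed:
  assumes D: "closedin (vietoris E) D" "D \<inter> I = {}"
  shows "\<exists>\<H>. countable \<H> \<and> (\<forall>H\<in>\<H>. good H) \<and> D \<subseteq> \<Union>\<H>"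
proof -
  define SG where "SG X \<longleftrightarrow> (\<exists>\<H>. countable \<H> \<and> (\<forall>H\<in>\<H>. good H) \<and> X \<subseteq> \<Union>\<H>)" for X
  define B where "B = (\<lambda>(n, ns). vbox E (b n) (b ` set ns))"
  define G where "G = (\<Union>p \<in> {p. SG (D \<inter> B p)}. B p)"
  have "\<forall>p. \<exists>\<H>. SG (D \<inter> B p) \<longrightarrow> countable \<H> \<and> (\<forall>H\<in>\<H>. good H) \<and> D \<inter> B p \<subseteq> \<Union>\<H>"
    by (simp add: SG_def)
  from choice[OF this] have "\<exists>h. \<forall>p. SG (D \<inter> B p) \<longrightarrow> countable (h p) \<and> (\<forall>H\<in>h p. good H) \<and> D \<inter> B p \<subseteq> \<Union>(h p)"
    .
  then obtain h where h: "\<And>p. SG (D \<inter> B p) \<Longrightarrow> countable (h p) \<and> (\<forall>H\<in>h p. good H) \<and> D \<inter> B p \<subseteq> \<Union>(h p)"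
    by blast
  let ?h = "\<Union>p \<in> {p. SG (D \<inter> B p)}. h p"
  have hG: "countable ?h" "\<forall>H\<in>?h. good H"
    by (rule countable_UN[OF countableI_type]) (simp_all add: h)
  have hG3: "D \<inter> G \<subseteq> \<Union>?h"
  proof
    fix M assume "M \<in> D \<inter> G"
    then obtain p where p: "SG (D \<inter> B p)" "M \<in> D \<inter> B p" unfolding G_def by blast
    then have "M \<in> \<Union>(h p)" using h[OF p(1)] by (meson subsetD)
    then show "M \<in> \<Union>?h" using p(1) by blast
  qed
  have "openin (vietoris E) (B p)" for p
    unfolding B_def using openin_bbox by (simp add: case_prod_beta)
  then have "openin (vietoris E) G" unfolding G_def by blast
  then have cl: "closedin (vietoris E) (D - G)" using D(1) by (simp add: closedin_diff)
  have "D - G = {}"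
  proof (rule ccontr)
    assume ne: "D - G \<noteq> {}"
    have "(D - G) \<inter> I = {}" using D(2) by blast
    then obtain n ns H where H: "(D - G) \<inter> vbox E (b n) (b ` set ns) \<noteq> {}" "good H"
      "(D - G) \<inter> vbox E (b n) (b ` set ns) \<subseteq> H"
      using good_local[OF cl ne] by blast
    have cov: "D \<inter> B (n, ns) \<subseteq> \<Union>(insert H ?h)" using H(3) hG3 unfolding B_def by auto
    have "SG (D \<inter> B (n, ns))"
      unfolding SG_def[of "D \<inter> B (n, ns)"] using hG H(2) cov
      by (intro exI[of _ "insert H ?h"]) (simp only: countable_insert_eq ball_simps simp_thms)
    then have "B (n, ns) \<subseteq> G" unfolding G_def by blast
    then show False using H(1) unfolding B_def by auto
  qed
  then have "D \<subseteq> \<Union>?h" using hG3 by blast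
  then show ?thesis using hG by (intro exI[of _ ?h]) simp
qed

text \<open>Here the G_\<delta> hypothesis on \<open>I\<close> enters: the compact sets outside
  \<open>I\<close> form a countable union of closed families.\<close>

lemma good_cover:
  obtains \<H> where "countable \<H>" "\<And>H. H \<in> \<H> \<Longrightarrow> good H"
    "\<And>K. closedin E K \<Longrightarrow> K \<notin> I \<Longrightarrow> \<exists>H\<in>\<H>. K \<in> H"
proof -
  have "fsigma_in (vietoris E) (compacts E - I)"
    using gdelta by (simp add: gdelta_in_fsigma_in topspace_vietoris)
  then obtain D where D: "\<And>n::nat. closedin (vietoris E) (D n)" "\<Union>(range D) = compacts E - I"
    unfolding fsigma_in_ascending by metis
  have "\<exists>\<H>. countable \<H> \<and> (\<forall>H\<in>\<H>. good H) \<and> D n \<subseteq> \<Union>\<H>" for n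
    using D by (intro good_cover_closed) auto
  then obtain h where h: "\<And>n. countable (h n)" "\<And>n H. H \<in> h n \<Longrightarrow> good H" "\<And>n. D n \<subseteq> \<Union>(h n)"
    by metis
  show thesis
  proof (rule that[of "\<Union>n. h n"])
    show "countable (\<Union>n. h n)" using h(1) by simp
    show "good H" if "H \<in> (\<Union>n. h n)" for H using that h(2) by blast
    fix K assume "closedin E K" "K \<notin> I"
    then have "K \<in> \<Union>(range D)" using D(2) compacts_iff by blast
    then show "\<exists>H\<in>\<Union>n. h n. K \<in> H" using h(3) by blast
  qed
qed


section \<open>The representing family when a kernel exists\<close>

text \<open>The sets \<open>W n\<close> mark the good families \<open>h n\<close>: a member of the representing family that misses
  \<open>W n\<close> is forced to meet all members of \<open>h n\<close>, while almost every marker is hit by any open set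
  meeting \<open>X\<close>, and no marker covers the others there.\<close>

lemma separating_sequence:
  assumes X: "closedin E X"
    and thick: "\<And>U K. \<lbrakk>openin E U; U \<inter> X \<noteq> {}; K \<in> I\<rbrakk> \<Longrightarrow> \<not> U \<inter> X \<subseteq> K"
    and dense: "\<And>U. \<lbrakk>openin E U; U \<inter> X \<noteq> {}\<rbrakk> \<Longrightarrow> \<exists>x\<in>U \<inter> X. {x} \<in> I"
    and h: "\<And>n::nat. good (h n)"
  obtains W :: "nat \<Rightarrow> 'a set" where "\<And>n. closedin E (W n)" "\<And>n. W n \<subseteq> X"
    "\<And>n U. \<lbrakk>openin E U; U \<inter> W n \<noteq> {}\<rbrakk> \<Longrightarrow> \<exists>V. openin E V \<and> V \<subseteq> U \<and> V \<inter> X \<noteq> {} \<and> V \<inter> X \<subseteq> W n"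
    "\<And>i m. \<lbrakk>b i \<inter> X \<noteq> {}; i \<le> m\<rbrakk> \<Longrightarrow> \<exists>z\<in>b i \<inter> W m. \<forall>n\<ge>i. n \<noteq> m \<longrightarrow> z \<notin> W n"
    "\<And>k l n. \<lbrakk>E closure_of b k \<notin> h l; k \<le> n; l \<le> n\<rbrakk> \<Longrightarrow> E closure_of b k \<union> W n \<notin> h l"
proof -
  let ?J = "\<lambda>i. b i \<inter> X \<noteq> {}"
  \<comment> \<open>\<open>p i\<close> is kept out of every later \<open>W n\<close>, so that \<open>b i\<close> is never exhausted.\<close>
  define p where "p i = (SOME x. x \<in> b i \<inter> X \<and> {x} \<in> I)" for i
  have p: "p i \<in> b i" "p i \<in> X" "{p i} \<in> I" if "?J i" for i
  proof -
    have "\<exists>x. x \<in> b i \<inter> X \<and> {x} \<in> I" using dense[OF open_b that] by blast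
    from someI_ex[OF this] show "p i \<in> b i" "p i \<in> X" "{p i} \<in> I" unfolding p_def by auto
  qed
  \<comment> \<open>For closed \<open>W \<subseteq> X\<close> this says that \<open>W\<close> is the
    closure of its interior relative to \<open>X\<close>. As \<open>X\<close> is thick, no open part
    of such a \<open>W\<close> can be hidden in a member of \<open>I\<close>.\<close>
  define reg where "reg W \<longleftrightarrow> (\<forall>U. openin E U \<longrightarrow> U \<inter> W \<noteq> {} \<longrightarrow>
     (\<exists>V. openin E V \<and> V \<subseteq> U \<and> V \<inter> X \<noteq> {} \<and> V \<inter> X \<subseteq> W))" for W
  \<comment> \<open>In a stage \<open>r\<close>, \<open>snd r\<close> becomes the marker
    \<open>W m\<close>, and \<open>fst r i\<close> is a point of \<open>b i\<close> reserved for it: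
    earlier markers with index at least \<open>i\<close> avoid this point, and so do all later
    ones.\<close>
  define P where "P f m r \<longleftrightarrow> closedin E (snd r) \<and> snd r \<subseteq> X \<and> reg (snd r) \<and>
      (\<forall>i\<le>m. ?J i \<longrightarrow> fst r i \<in> b i \<and> fst r i \<in> snd r \<and> {fst r i} \<in> I \<and>
         (\<forall>n. i \<le> n \<longrightarrow> n < m \<longrightarrow> fst r i \<notin> snd (f n))) \<and>
      (\<forall>n<m. \<forall>i\<le>n. ?J i \<longrightarrow> fst (f n) i \<notin> snd r) \<and>
      (\<forall>i\<le>m. ?J i \<longrightarrow> p i \<notin> snd r) \<and>
      (\<forall>k\<le>m. \<forall>l\<le>m. E closure_of b k \<notin> h l \<longrightarrow> E closure_of b k \<union> snd r \<notin> h l)"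
    for f :: "nat \<Rightarrow> (nat \<Rightarrow> 'a) \<times> 'a set" and m :: nat and r
  have "\<exists>f. \<forall>m. P f m (f m)"
  proof (rule dependent_wf_choice[of less_than])
    show "wf less_than" by simp
  next
    fix f g :: "nat \<Rightarrow> (nat \<Rightarrow> 'a) \<times> 'a set" and m :: nat and r
    assume "\<And>z. (z, m) \<in> less_than \<Longrightarrow> f z = g z"
    then have "f n = g n" if "n < m" for n using that by simp
    then show "P f m r = P g m r" unfolding P_def by auto
  next
    fix m :: nat and f :: "nat \<Rightarrow> (nat \<Rightarrow> 'a) \<times> 'a set"
    assume "\<And>n. (n, m) \<in> less_than \<Longrightarrow> P f n (f n)"
    then have f: "P f n (f n)" if "n < m" for n using that by simp
    define T where "T = p ` {i. i \<le> m \<and> ?J i} \<union> (\<Union>n\<in>{..<m}. fst (f n) ` {i. i \<le> n \<and> ?J i})"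
    have "T \<in> I"
    proof (rule I_finite)
      show "finite T" unfolding T_def by simp
      fix x assume "x \<in> T"
      then consider i where "?J i" "x = p i"
        | n i where "n < m" "i \<le> n" "?J i" "x = fst (f n) i" unfolding T_def by auto
      then show "{x} \<in> I"
        by cases (use p f in \<open>auto simp: P_def\<close>)
    qed
    then have cT: "closedin E T" by (rule I_closed)
    define N where "N i = b i - (\<Union>n\<in>{i..<m}. snd (f n))" for i
    have oN: "openin E (N i)" for i
    proof -
      have "closedin E (\<Union>n\<in>{i..<m}. snd (f n))"
        using f by (intro closedin_Union) (auto simp: P_def)
      then show ?thesis unfolding N_def by (simp add: openin_diff open_b)
    qed
    \<comment> \<open>The guarded point \<open>p i\<close> keeps \<open>N i \<inter> X\<close>
      nonempty, thickness of \<open>X\<close> prevents the finite set \<open>T\<close> from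
      exhausting it, and density provides a point whose singleton is in \<open>I\<close>.\<close>
    have "\<exists>z. z \<in> N i \<inter> X - T \<and> {z} \<in> I" if i: "i \<le> m" "?J i" for i
    proof -
      have "p i \<in> N i" using p(1)[OF i(2)] f i(2) unfolding N_def P_def by auto
      then have "N i \<inter> X \<noteq> {}" using p(2)[OF i(2)] by blast
      then have "\<not> N i \<inter> X \<subseteq> T" using thick[OF oN] \<open>T \<in> I\<close> by blast
      then have "(N i - T) \<inter> X \<noteq> {}" by blast
      moreover have "openin E (N i - T)" using oN cT by (simp add: openin_diff)
      ultimately show ?thesis using dense by blast
    qed
    then obtain z where z: "\<And>i. \<lbrakk>i \<le> m; ?J i\<rbrakk> \<Longrightarrow> z i \<in> N i \<inter> X - T \<and> {z i} \<in> I"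
      by metis
    define Z where "Z = z ` {i. i \<le> m \<and> ?J i}"
    have Z: "Z \<in> I" "Z \<subseteq> X - T"
      using I_finite[of Z] z unfolding Z_def by auto
    \<comment> \<open>Since \<open>Z\<close> belongs to \<open>I\<close>, adding it to a base
      closure outside \<open>h l\<close> does not lead into \<open>h l\<close>, and this persists
      for small neighbourhoods of \<open>Z\<close>. The marker is then taken in a neighbourhood that
      serves all \<open>k, l \<le> m\<close>.\<close>
    have "\<exists>U. openin E U \<and> Z \<subseteq> U \<and>
        (E closure_of b k \<notin> h l \<longrightarrow> E closure_of b k \<subseteq> U \<and> (\<forall>M\<in>h l. \<not> M \<subseteq> U))" for k l
    proof (cases "E closure_of b k \<in> h l")
      case True
      have "Z \<subseteq> topspace E" using I_closed[OF Z(1)] closedin_subset by blast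
      then show ?thesis using True by (intro exI[of _ "topspace E"]) simp
    next
      case False
      have "E closure_of b k \<union> Z \<notin> h l"
        by (rule good_Un[OF h _ False Z(1)]) simp
      moreover have "closedin E (E closure_of b k \<union> Z)"
        using I_closed[OF Z(1)] by (simp add: closedin_Un)
      ultimately obtain U where "openin E U" "E closure_of b k \<union> Z \<subseteq> U" "\<And>M. M \<in> h l \<Longrightarrow> \<not> M \<subseteq> U"
        using good_outside[OF h] by metis
      then show ?thesis by (intro exI[of _ U]) simp
    qed
    then obtain U where U: "\<And>k l. openin E (U k l)" "\<And>k l. Z \<subseteq> U k l"
      "\<And>k l. E closure_of b k \<notin> h l \<Longrightarrow> E closure_of b k \<subseteq> U k l"
      "\<And>k l M. \<lbrakk>E closure_of b k \<notin> h l; M \<in> h l\<rbrakk> \<Longrightarrow> \<not> M \<subseteq> U k l"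
      by metis
    define U0 where "U0 = (\<Inter>k\<in>{..m}. \<Inter>l\<in>{..m}. U k l) - T"
    have "openin E U0"
      unfolding U0_def using U(1) cT by (intro openin_diff openin_INT2) auto
    moreover have "Z \<subseteq> U0" unfolding U0_def using U(2) Z(2) by blast
    ultimately obtain n where n: "Z \<subseteq> b n" "E closure_of b n \<subseteq> U0"
      using base I_closed[OF Z(1)] by blast
    define W where "W = E closure_of (X \<inter> b n)"
    have WX: "W \<subseteq> X" unfolding W_def using X by (simp add: closure_of_minimal)
    have "W \<subseteq> E closure_of b n" unfolding W_def by (simp add: closure_of_mono)
    then have WU: "W \<subseteq> U0" using n(2) by blast
    have sub: "X \<inter> b n \<subseteq> W" unfolding W_def using X closedin_subset by (intro closure_of_subset) blast
    have ZW: "Z \<subseteq> W" using sub n(1) Z(2) by blast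
    have "reg W"
      unfolding reg_def
    proof (intro allI impI)
      fix V assume V: "openin E V" "V \<inter> W \<noteq> {}"
      then have "V \<inter> (X \<inter> b n) \<noteq> {}" unfolding W_def by (metis openin_Int_closure_of_eq_empty)
      then show "\<exists>V'. openin E V' \<and> V' \<subseteq> V \<and> V' \<inter> X \<noteq> {} \<and> V' \<inter> X \<subseteq> W"
        using sub V(1) open_b by (intro exI[of _ "V \<inter> b n"]) (simp add: openin_Int, blast)
    qed
    have "P f m (z, W)"
      unfolding P_def fst_conv snd_conv
    proof (intro conjI allI impI)
      show "closedin E W" unfolding W_def by simp
      show "W \<subseteq> X" "reg W" by fact+
      show "z i \<in> b i" "{z i} \<in> I" if "i \<le> m" "?J i" for i
        using z[OF that] unfolding N_def by auto
      show "z i \<in> W" if "i \<le> m" "?J i" for i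
        using that ZW unfolding Z_def by blast
      show "z i \<notin> snd (f n)" if "i \<le> m" "?J i" "i \<le> n" "n < m" for i n
        using z[OF that(1,2)] that(3,4) unfolding N_def by auto
      show "fst (f n) i \<notin> W" if "n < m" "i \<le> n" "?J i" for i n
      proof -
        have "fst (f n) i \<in> T" using that unfolding T_def by blast
        then show ?thesis using WU unfolding U0_def by blast
      qed
      show "p i \<notin> W" if "i \<le> m" "?J i" for i
      proof -
        have "p i \<in> T" using that unfolding T_def by blast
        then show ?thesis using WU unfolding U0_def by blast
      qed
      show "E closure_of b k \<union> W \<notin> h l" if "k \<le> m" "l \<le> m" "E closure_of b k \<notin> h l" for k l
      proof -
        have "W \<subseteq> U k l" using WU that(1,2) unfolding U0_def by blast
        then show ?thesis using U(3,4)[OF that(3)] by blast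
      qed
    qed
    then show "\<exists>r. P f m r" by blast
  qed
  then obtain f where f: "\<And>m. P f m (f m)" by blast
  show thesis
  proof (rule that[of "\<lambda>n. snd (f n)"])
    fix n show "closedin E (snd (f n))" "snd (f n) \<subseteq> X" using f[of n] unfolding P_def by auto
  next
    fix n U assume "openin E U" "U \<inter> snd (f n) \<noteq> {}"
    moreover have "reg (snd (f n))" using f[of n] unfolding P_def by auto
    ultimately show "\<exists>V. openin E V \<and> V \<subseteq> U \<and> V \<inter> X \<noteq> {} \<and> V \<inter> X \<subseteq> snd (f n)"
      unfolding reg_def by simp
  next
    fix i m assume i: "?J i" "i \<le> m"
    have "fst (f m) i \<in> b i \<inter> snd (f m)" using f[of m] i unfolding P_def by auto
    moreover have "fst (f m) i \<notin> snd (f n)" if "i \<le> n" "n \<noteq> m" for n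
    proof (cases "n < m")
      case True
      then show ?thesis using f[of m] i that unfolding P_def by auto
    next
      case False
      then have "m < n" using that by simp
      then show ?thesis using f[of n] i unfolding P_def by auto
    qed
    ultimately show "\<exists>z\<in>b i \<inter> snd (f m). \<forall>n\<ge>i. n \<noteq> m \<longrightarrow> z \<notin> snd (f n)" by blast
  next
    fix k l n assume "E closure_of b k \<notin> h l" "k \<le> n" "l \<le> n"
    then show "E closure_of b k \<union> snd (f n) \<notin> h l" using f[of n] unfolding P_def by auto
  qed
qed

end

lemma closedin_vietoris_hits_all:
  assumes "\<And>M. M \<in> H \<Longrightarrow> closedin E M"
  shows "closedin (vietoris E) {L \<in> compacts E. \<forall>M\<in>H. L \<inter> M \<noteq> {}}"
proof -
  have "closedin (vietoris E) (\<Inter>(insert (compacts E) (hits E ` H)))"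
    using assms closedin_vietoris_hits closedin_topspace[of "vietoris E"]
    by (intro closedin_Inter) (auto simp: topspace_vietoris)
  moreover have "\<Inter>(insert (compacts E) (hits E ` H)) = {L \<in> compacts E. \<forall>M\<in>H. L \<inter> M \<noteq> {}}"
    by (auto simp: hits_def)
  ultimately show ?thesis by simp
qed

section \<open>Testing meagerness of hit sets on boxes\<close>

context compact_base
begin

lemma thin_in_vietorisI:
  assumes "closedin (vietoris E) N"
    and "\<And>U \<U> L. \<lbrakk>openin E U; finite \<U>; \<And>V. V \<in> \<U> \<Longrightarrow> openin E V; L \<in> F; L \<in> vbox E U \<U>\<rbrakk>
      \<Longrightarrow> \<exists>L'\<in>F. L' \<in> vbox E U \<U> \<and> L' \<notin> N"
  shows "thin_in (vietoris E) F N"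
  unfolding thin_in_def
proof (intro conjI allI impI)
  show "closedin (vietoris E) N" by fact
  fix W assume W: "openin (vietoris E) W" "W \<inter> F \<noteq> {}"
  then obtain L where L: "L \<in> W" "L \<in> F" by blast
  obtain n ns where n: "L \<in> vbox E (b n) (b ` set ns)" "vbox E (b n) (b ` set ns) \<subseteq> W"
    by (rule vbox_base[OF W(1) L(1)])
  have "\<exists>L'\<in>F. L' \<in> vbox E (b n) (b ` set ns) \<and> L' \<notin> N"
    using open_b L(2) n(1) by (intro assms(2)) auto
  then show "\<not> W \<inter> F \<subseteq> N" using n(2) by blast
qed

text \<open>For \<open>x \<in> G\<close> the Baire category theorem in \<open>{L \<in> F. x \<in> L}\<close> puts
  \<open>x\<close> into one of countably many sets \<open>T\<close>, each relatively closed in an open set because \<open>F\<close> is closed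
  under adding points of \<open>S\<close>.\<close>

lemma covered_of_meager:
  assumes F: "closedin (vietoris E) F" and S: "closedin E S" "S \<in> F"
    and up: "\<And>L y. \<lbrakk>L \<in> F; y \<in> S\<rbrakk> \<Longrightarrow> insert y L \<in> F"
    and dagger: "\<And>K n ns. \<lbrakk>closedin E K; K \<subseteq> S; K \<notin> I; K \<subseteq> b n; F \<inter> vbox E (b n) (b ` set ns) \<noteq> {}\<rbrakk>
       \<Longrightarrow> \<exists>W. openin (vietoris E) W \<and> W \<inter> F \<noteq> {} \<and> W \<inter> F \<subseteq> vbox E (b n) (b ` set ns) \<inter> hits E K"
    and G: "G \<subseteq> S" and m: "hits_meager_in E F G"
  shows "countably_covered_by I G"
proof -
  have FS: "F \<subseteq> compacts E" using F closedin_subset topspace_vietoris by metis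
  obtain \<N> where \<N>: "countable \<N>" "\<And>N. N \<in> \<N> \<Longrightarrow> thin_in (vietoris E) F N" "hits E G \<inter> F \<subseteq> \<Union>\<N>"
    using m F unfolding hits_meager_in_def by (auto simp: meager_in_subtopology_iff)
  define B where "B n ns = vbox E (b n) (b ` set ns)" for n ns
  define T where "T n ns N = {x \<in> S \<inter> b n. \<forall>L \<in> B n ns \<inter> F. x \<in> L \<longrightarrow> L \<in> N}" for n ns N
  define Kf where "Kf = (\<lambda>(n, ns, k, N). T n ns N \<inter> E closure_of b k)"
  define J where "J = {(n, ns, k, N). N \<in> \<N> \<and> E closure_of b k \<subseteq> b n \<and> B n ns \<inter> F \<noteq> {}}"
  have "J \<subseteq> UNIV \<times> UNIV \<times> UNIV \<times> \<N>" unfolding J_def by auto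
  moreover have "countable ((UNIV::nat set) \<times> (UNIV::nat list set) \<times> (UNIV::nat set) \<times> \<N>)"
    using \<N>(1) by (intro countable_SIGMA) auto
  ultimately have cJ: "countable J" by (rule countable_subset)
  have inI: "T n ns N \<inter> E closure_of b k \<in> I"
    if N: "N \<in> \<N>" and k: "E closure_of b k \<subseteq> b n" and ne: "B n ns \<inter> F \<noteq> {}" for n ns k N
  proof -
    let ?K = "T n ns N \<inter> E closure_of b k"
    have tN: "closedin (vietoris E) N" "\<And>W. \<lbrakk>openin (vietoris E) W; W \<inter> F \<noteq> {}\<rbrakk> \<Longrightarrow> \<not> W \<inter> F \<subseteq> N"
      using \<N>(2)[OF N] unfolding thin_in_def by auto
    have KS: "?K \<subseteq> S" unfolding T_def by blast
    have "E closure_of ?K \<subseteq> ?K"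
    proof
      fix x assume x: "x \<in> E closure_of ?K"
      have xk: "x \<in> E closure_of b k"
        using x closure_of_minimal[of ?K "E closure_of b k" E] by auto
      have xS: "x \<in> S" using x closure_of_minimal[OF KS S(1)] by auto
      have "L \<in> N" if L: "L \<in> B n ns" "L \<in> F" "x \<in> L" for L
      proof (rule ccontr)
        assume "L \<notin> N"
        then have "L \<in> compacts E - N" using L(2) FS by blast
        moreover have "openin (vietoris E) (compacts E - N)"
          using tN(1) openin_diff[OF openin_topspace] by (metis topspace_vietoris)
        ultimately obtain n' ns' where n': "L \<in> vbox E (b n') (b ` set ns')"
          "vbox E (b n') (b ` set ns') \<subseteq> compacts E - N"
          using vbox_base by metis
        have "x \<in> b n'" using n'(1) L(3) unfolding vbox_def by blast
        then obtain y where y: "y \<in> T n ns N" "y \<in> b n'"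
          using x open_b unfolding in_closure_of by blast
        have y': "y \<in> S" "y \<in> b n" using y(1) unfolding T_def by auto
        \<comment> \<open>The point \<open>y\<close> lies in \<open>b n\<close> and in
          \<open>b n'\<close>, so adding it to \<open>L\<close> leaves neither box. Then
          \<open>y \<in> T n ns N\<close> puts the enlarged set into \<open>N\<close>, while the
          second box is disjoint from \<open>N\<close>.\<close>
        have LF: "insert y L \<in> F" using up[OF L(2) y'(1)] .
        then have c: "insert y L \<in> compacts E" using FS by blast
        have "insert y L \<in> B n ns" using c L(1) y'(2) unfolding B_def vbox_def by auto
        then have "insert y L \<in> N" using y(1) LF unfolding T_def by blast
        moreover have "insert y L \<in> vbox E (b n') (b ` set ns')"
          using c n'(1) y(2) unfolding vbox_def by auto
        ultimately show False using n'(2) by blast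
      qed
      then have "x \<in> T n ns N" using xS xk k unfolding T_def by blast
      then show "x \<in> ?K" using xk by blast
    qed
    moreover have "?K \<subseteq> topspace E" using KS S(1) closedin_subset by blast
    ultimately have cK: "closedin E ?K" by (metis closure_of_subset closure_of_eq subset_antisym)
    show ?thesis
    proof (rule ccontr)
      assume nI: "?K \<notin> I"
      have Kb: "?K \<subseteq> b n" using k by blast
      have "F \<inter> vbox E (b n) (b ` set ns) \<noteq> {}" using ne unfolding B_def by blast
      then obtain W where W: "openin (vietoris E) W" "W \<inter> F \<noteq> {}"
        "W \<inter> F \<subseteq> vbox E (b n) (b ` set ns) \<inter> hits E ?K"
        using dagger[OF cK KS nI Kb] by metis
      have "W \<inter> F \<subseteq> N"
      proof
        fix L assume L: "L \<in> W \<inter> F"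
        then have "L \<in> B n ns" "L \<in> hits E ?K" using W(3) unfolding B_def by auto
        moreover then obtain y where "y \<in> L" "y \<in> T n ns N" unfolding hits_def by blast
        ultimately show "L \<in> N" using L unfolding T_def by blast
      qed
      then show False using tN(2)[OF W(1,2)] by blast
    qed
  qed
  have "Kf j \<in> I" if "j \<in> J" for j
  proof -
    obtain n ns k N where j: "j = (n, ns, k, N)" by (cases j)
    have "N \<in> \<N>" "E closure_of b k \<subseteq> b n" "B n ns \<inter> F \<noteq> {}"
      using that unfolding j J_def by simp_all
    from inI[OF this] show ?thesis unfolding j Kf_def by simp
  qed
  then have "Kf ` J \<subseteq> I" by (rule image_subsetI)
  moreover have "G \<subseteq> \<Union>(Kf ` J)"
  proof
    fix x assume xG: "x \<in> G"
    then have xS: "x \<in> S" using G by blast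
    then have x: "x \<in> topspace E" using S(1) closedin_subset by blast
    let ?Fx = "F \<inter> hits E {x}"
    have "closedin (vietoris E) ?Fx"
      using F closedin_vietoris_hits[OF closedin_singleton[OF x]] by blast
    moreover have "openin (vietoris E) (compacts E)"
      using openin_topspace[of "vietoris E"] by (simp add: topspace_vietoris)
    moreover have "S \<in> compacts E \<inter> ?Fx" using S(2) FS xS unfolding hits_def by blast
    moreover have "compacts E \<inter> ?Fx \<subseteq> \<Union>\<N>"
    proof -
      have "?Fx \<subseteq> hits E G \<inter> F" using xG unfolding hits_def by blast
      then show ?thesis using \<N>(3) by blast
    qed
    moreover have "closedin (vietoris E) N" if "N \<in> \<N>" for N
      using \<N>(2)[OF that] unfolding thin_in_def by blast
    ultimately obtain N V where N: "N \<in> \<N>" and V: "openin (vietoris E) V" "V \<inter> ?Fx \<noteq> {}" "V \<inter> ?Fx \<subseteq> N"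
      using Baire_vietoris[of ?Fx "compacts E" \<N>] \<N>(1) by (metis empty_iff)
    then obtain L where L: "L \<in> V" "L \<in> F" "x \<in> L" unfolding hits_def by blast
    obtain n ns where n: "L \<in> vbox E (b n) (b ` set ns)" "vbox E (b n) (b ` set ns) \<subseteq> V"
      by (rule vbox_base[OF V(1) L(1)])
    have xn: "x \<in> b n" using n(1) L(3) unfolding vbox_def by blast
    have xT: "x \<in> T n ns N"
    proof -
      have "L' \<in> N" if "L' \<in> B n ns" "L' \<in> F" "x \<in> L'" for L'
        using that n(2) V(3) FS unfolding B_def hits_def by blast
      then show ?thesis using xS xn unfolding T_def by blast
    qed
    obtain k where k: "x \<in> b k" "E closure_of b k \<subseteq> b n"
      by (rule base_point[OF open_b xn])
    have "B n ns \<inter> F \<noteq> {}" using n(1) L(2) unfolding B_def by blast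
    then have "(n, ns, k, N) \<in> J" using N k(2) unfolding J_def by simp
    moreover have "x \<in> Kf (n, ns, k, N)"
      using xT k(1) b_subset_closure[of k] unfolding Kf_def by auto
    ultimately show "x \<in> \<Union>(Kf ` J)" by blast
  qed
  ultimately show ?thesis
    unfolding countably_covered_by_def using cJ by (intro exI[of _ "Kf ` J"]) simp
qed

lemma meager_of_covered:
  assumes F: "closedin (vietoris E) F" "\<And>L. L \<in> F \<Longrightarrow> L \<subseteq> S"
    and thin: "\<And>K. K \<in> I \<Longrightarrow> thin_in (vietoris E) F (hits E K)"
    and G: "countably_covered_by I (G \<inter> S)"
  shows "hits_meager_in E F G"
proof -
  obtain \<C> where \<C>: "countable \<C>" "\<C> \<subseteq> I" "G \<inter> S \<subseteq> \<Union>\<C>"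
    using G unfolding countably_covered_by_def by blast
  have "hits E G \<inter> F \<subseteq> \<Union>(hits E ` \<C>)"
  proof
    fix L assume L: "L \<in> hits E G \<inter> F"
    then obtain x where "x \<in> L" "x \<in> G \<inter> S" using F(2) unfolding hits_def by blast
    then show "L \<in> \<Union>(hits E ` \<C>)" using \<C>(3) L unfolding hits_def by blast
  qed
  then show ?thesis
    unfolding hits_meager_in_def using \<C> thin F(1)
    by (subst meager_in_subtopology_iff) (auto intro!: exI[of _ "hits E ` \<C>"])
qed

end

text \<open>\<open>h_local\<close> provides, for a compact set outside \<open>I\<close>, a family
  containing it whose requirement can be met close to that set. \<open>h_repeat\<close> lets the
  index of this family be as large as smallness of the marker demands.\<close>

locale separated_kernel = gdelta_ideal E b I for E :: "'a topology" and b I +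
  fixes S X :: "'a set" and h :: "nat \<Rightarrow> 'a set set" and W :: "nat \<Rightarrow> 'a set"
  assumes S: "closedin E S"
    and S_thick: "\<lbrakk>openin E U; U \<inter> S \<noteq> {}; K \<in> I\<rbrakk> \<Longrightarrow> \<not> U \<inter> S \<subseteq> K"
    and X: "closedin E X" "X \<subseteq> S" "X \<noteq> {}"
    and X_thick: "\<lbrakk>openin E U; U \<inter> X \<noteq> {}; K \<in> I\<rbrakk> \<Longrightarrow> \<not> U \<inter> X \<subseteq> K"
    and h_good: "good (h n)"
    and h_S: "M \<in> h n \<Longrightarrow> M \<inter> S \<in> h n"
    and h_local: "\<lbrakk>closedin E K; K \<subseteq> S; K \<notin> I; openin E U; K \<subseteq> U\<rbrakk>
      \<Longrightarrow> \<exists>m T. K \<in> h m \<and> closedin E T \<and> T \<subseteq> U \<inter> S \<and> (\<forall>M\<in>h m. M \<inter> T \<in> h m)"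
    and h_repeat: "\<exists>\<^sub>F n in sequentially. h n = h m"
    and W_closed: "closedin E (W n)" and W_X: "W n \<subseteq> X"
    and W_regular: "\<lbrakk>openin E U; U \<inter> W n \<noteq> {}\<rbrakk>
      \<Longrightarrow> \<exists>V. openin E V \<and> V \<subseteq> U \<and> V \<inter> X \<noteq> {} \<and> V \<inter> X \<subseteq> W n"
    and W_point: "\<lbrakk>b i \<inter> X \<noteq> {}; i \<le> m\<rbrakk> \<Longrightarrow> \<exists>z\<in>b i \<inter> W m. \<forall>n\<ge>i. n \<noteq> m \<longrightarrow> z \<notin> W n"
    and W_small: "\<lbrakk>E closure_of b k \<notin> h l; k \<le> n; l \<le> n\<rbrakk> \<Longrightarrow> E closure_of b k \<union> W n \<notin> h l"
begin

lemma base_hit: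
  assumes "openin E U" "U \<inter> X \<noteq> {}"
  obtains i where "b i \<subseteq> U" "b i \<inter> X \<noteq> {}"
proof -
  obtain x where x: "x \<in> U" "x \<in> X" using assms(2) by blast
  obtain i where "x \<in> b i" "E closure_of b i \<subseteq> U" by (rule base_point[OF assms(1) x(1)])
  then show thesis using that[of i] x(2) b_subset_closure[of i] by blast
qed

lemma W_hits:
  assumes "openin E U" "U \<inter> X \<noteq> {}"
  shows "\<forall>\<^sub>F n in sequentially. U \<inter> W n \<noteq> {}"
proof -
  obtain i where i: "b i \<subseteq> U" "b i \<inter> X \<noteq> {}" by (rule base_hit[OF assms])
  have "U \<inter> W n \<noteq> {}" if "i \<le> n" for n using W_point[OF i(2) that] i(1) by blast
  then show ?thesis unfolding eventually_sequentially by blast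
qed

lemma W_separated:
  assumes "openin E U" "U \<inter> X \<noteq> {}"
  obtains N where "\<And>m n. \<lbrakk>N \<le> m; N \<le> n; m \<noteq> n\<rbrakk> \<Longrightarrow> \<not> U \<inter> W m \<subseteq> W n"
proof -
  obtain i where i: "b i \<subseteq> U" "b i \<inter> X \<noteq> {}" by (rule base_hit[OF assms])
  have "\<not> U \<inter> W m \<subseteq> W n" if "i \<le> m" "i \<le> n" "m \<noteq> n" for m n
    using W_point[OF i(2) that(1)] i(1) that by blast
  then show thesis by (rule that)
qed

lemma W_thin:
  assumes "openin E U" "U \<inter> X \<noteq> {}"
  shows "\<forall>\<^sub>F n in sequentially. \<not> U \<inter> X \<subseteq> W n"
proof -
  obtain N where N: "\<And>m n. \<lbrakk>N \<le> m; N \<le> n; m \<noteq> n\<rbrakk> \<Longrightarrow> \<not> U \<inter> W m \<subseteq> W n"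
    using W_separated[OF assms] by metis
  \<comment> \<open>The marker \<open>W N\<close>, a subset of \<open>X\<close>, is the part of
    \<open>X\<close> that is not covered; \<open>Suc N\<close> ensures
    \<open>n \<noteq> N\<close>.\<close>
  have "\<not> U \<inter> X \<subseteq> W n" if "Suc N \<le> n" for n
    using N[of N n] that W_X[of N] by auto
  then show ?thesis unfolding eventually_sequentially by blast
qed

text \<open>The construction secures smallness only for base closures with index at most
  \<open>n\<close>; an arbitrary \<open>C\<close> is enclosed in a base set whose closure is still
  outside \<open>h l\<close>.\<close>

lemma W_negligible:
  assumes C: "closedin E C" "C \<notin> h l"
  shows "\<forall>\<^sub>F n in sequentially. C \<union> W n \<notin> h l"
proof -
  obtain U where U: "openin E U" "C \<subseteq> U" "\<And>M. M \<in> h l \<Longrightarrow> \<not> M \<subseteq> U"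
    using good_outside[OF h_good C] by metis
  obtain k where k: "C \<subseteq> b k" "E closure_of b k \<subseteq> U" using base[OF C(1) U(1,2)] by blast
  have nk: "E closure_of b k \<notin> h l" using U(3) k(2) by blast
  have "C \<union> W n \<notin> h l" if "max k l \<le> n" for n
  proof
    assume "C \<union> W n \<in> h l"
    moreover have "closedin E (E closure_of b k \<union> W n)" using W_closed by (simp add: closedin_Un)
    moreover have "C \<union> W n \<subseteq> E closure_of b k \<union> W n" using k(1) b_subset_closure[of k] by blast
    ultimately have "E closure_of b k \<union> W n \<in> h l" by (rule good_mono[OF h_good])
    then show False using W_small[OF nk] that by simp
  qed
  then show ?thesis unfolding eventually_sequentially by blast
qed

text \<open>The clause \<open>L \<inter> X \<noteq> {}\<close> ensures that an open set containing a
  member of \<open>F\<close> meets \<open>X\<close>, and therefore meets almost all markers.\<close>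

definition F :: "'a set set" where
  "F = {L. closedin E L \<and> L \<subseteq> S \<and> L \<inter> X \<noteq> {} \<and> (\<forall>n. L \<inter> W n \<noteq> {} \<or> (\<forall>M\<in>h n. L \<inter> M \<noteq> {}))}"

lemma closedin_F: "closedin (vietoris E) F"
proof -
  let ?A = "\<lambda>n. hits E (W n) \<union> {L \<in> compacts E. \<forall>M\<in>h n. L \<inter> M \<noteq> {}}"
  have eq: "F = {L \<in> compacts E. L \<subseteq> S} \<inter> hits E X \<inter> (\<Inter>n. ?A n)"
    unfolding F_def hits_def compacts_iff by (rule set_eqI) (simp, metis)
  have "closedin (vietoris E) (?A n)" for n
    using W_closed good_closed[OF h_good]
    by (intro closedin_Un closedin_vietoris_hits closedin_vietoris_hits_all) auto
  then have "closedin (vietoris E) (\<Inter>n. ?A n)" by (intro closedin_INT) auto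
  then show ?thesis
    unfolding eq by (intro closedin_Int closedin_vietoris_hits closedin_vietoris_subset S X(1))
qed

lemma F_up: "\<lbrakk>K \<in> F; closedin E L; K \<subseteq> L; L \<subseteq> S\<rbrakk> \<Longrightarrow> L \<in> F"
proof -
  assume a: "K \<in> F" "closedin E L" "K \<subseteq> L" "L \<subseteq> S"
  have *: "K \<inter> A \<noteq> {} \<Longrightarrow> L \<inter> A \<noteq> {}" for A using a(3) by blast
  have "L \<inter> W n \<noteq> {} \<or> (\<forall>M\<in>h n. L \<inter> M \<noteq> {})" for n
    using a(1) * unfolding F_def by (metis (mono_tags, lifting) mem_Collect_eq)
  then show "L \<in> F" using a * unfolding F_def by blast
qed

lemma S_in_F: "S \<in> F"
proof -
  have "S \<inter> M \<noteq> {}" if "M \<in> h n" for n M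
    using h_S[OF that] good_empty[OF h_good[of n]] by (metis Int_commute)
  then show ?thesis using S X unfolding F_def by blast
qed

text \<open>The tool for producing members of \<open>F\<close>. A piece of \<open>X\<close> near a
  point of \<open>U - Q\<close> meets all \<open>W m\<close> with \<open>m \<ge> N\<close>; for each
  of the finitely many other \<open>m\<close> one adds either a point of \<open>W m\<close> or a set
  meeting all of \<open>h m\<close>; finitely many further points take care of \<open>\<U>\<close>.
  Everything is chosen off \<open>Q\<close>.\<close>

lemma F_avoiding:
  assumes U: "openin E U" and Q: "closedin E Q" and UX: "\<not> U \<inter> X \<subseteq> Q"
    and step: "\<And>m. \<not> U \<inter> W m \<subseteq> Q \<or> (\<exists>L. closedin E L \<and> L \<subseteq> S \<inter> U - Q \<and> (\<forall>M\<in>h m. L \<inter> M \<noteq> {}))"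
    and \<U>: "finite \<U>" "\<And>V. V \<in> \<U> \<Longrightarrow> \<not> V \<inter> U \<inter> S \<subseteq> Q"
  shows "\<exists>L\<in>F. L \<subseteq> U - Q \<and> (\<forall>V\<in>\<U>. L \<inter> V \<noteq> {})"
proof -
  obtain x where x: "x \<in> U - Q" "x \<in> X" using UX by blast
  have "openin E (U - Q)" using U Q by (simp add: openin_diff)
  then obtain i where i: "x \<in> b i" "E closure_of b i \<subseteq> U - Q" using base_point[OF _ x(1)] by metis
  have "b i \<inter> X \<noteq> {}" using i(1) x(2) by blast
  from W_hits[OF open_b this] obtain N where N: "\<And>n. N \<le> n \<Longrightarrow> b i \<inter> W n \<noteq> {}"
    unfolding eventually_sequentially by blast
  have "\<exists>L. closedin E L \<and> L \<subseteq> S \<inter> U - Q \<and> (L \<inter> W m \<noteq> {} \<or> (\<forall>M\<in>h m. L \<inter> M \<noteq> {}))" for m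
  proof (cases "U \<inter> W m \<subseteq> Q")
    case True
    then show ?thesis using step[of m] by metis
  next
    case False
    then obtain y where y: "y \<in> U" "y \<in> W m" "y \<notin> Q" by blast
    then have "closedin E {y}" using openin_subset[OF U] closedin_singleton by blast
    then show ?thesis using y W_X[of m] X(2) by (intro exI[of _ "{y}"]) auto
  qed
  then obtain g where g: "\<And>m. closedin E (g m)" "\<And>m. g m \<subseteq> S \<inter> U - Q"
    "\<And>m. g m \<inter> W m \<noteq> {} \<or> (\<forall>M\<in>h m. g m \<inter> M \<noteq> {})" by metis
  have "\<exists>y. y \<in> V \<inter> U \<inter> S - Q" if "V \<in> \<U>" for V using \<U>(2)[OF that] by blast
  then obtain y where y: "\<And>V. V \<in> \<U> \<Longrightarrow> y V \<in> V \<inter> U \<inter> S - Q" by metis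
  let ?M = "E closure_of b i \<inter> X"
  define L where "L = ?M \<union> (\<Union>m\<in>{..<N}. g m) \<union> y ` \<U>"
  have cy: "closedin E (y ` \<U>)"
  proof -
    have "closedin E (\<Union>V\<in>\<U>. {y V})"
      using \<U>(1) y openin_subset[OF U] closedin_singleton by (intro closedin_Union) auto
    moreover have "(\<Union>V\<in>\<U>. {y V}) = y ` \<U>" by blast
    ultimately show ?thesis by simp
  qed
  have cg: "closedin E (\<Union>m\<in>{..<N}. g m)"
    using g(1) by (intro closedin_Union) auto
  have cL: "closedin E L" unfolding L_def using cy cg X(1) by (intro closedin_Un) auto
  have sub: "?M \<subseteq> S \<inter> U - Q" using i(2) X(2) by blast
  have ysub: "y ` \<U> \<subseteq> S \<inter> U - Q" using y by auto
  have LS: "L \<subseteq> S \<inter> U - Q" unfolding L_def using sub ysub g(2) by (intro Un_least UN_least)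
  have MsubL: "?M \<subseteq> L" unfolding L_def by blast
  have "L \<inter> X \<noteq> {}" using MsubL i(1) x(2) b_subset_closure[of i] by blast
  moreover have "L \<inter> W n \<noteq> {} \<or> (\<forall>M\<in>h n. L \<inter> M \<noteq> {})" for n
  proof (cases "N \<le> n")
    case True
    then have "?M \<inter> W n \<noteq> {}" using N W_X[of n] b_subset_closure[of i] by blast
    then show ?thesis using MsubL by blast
  next
    case False
    then have "g n \<subseteq> L" unfolding L_def by auto
    then have "g n \<inter> A \<noteq> {} \<Longrightarrow> L \<inter> A \<noteq> {}" for A by blast
    then show ?thesis using g(3)[of n] by metis
  qed
  ultimately have "L \<in> F" unfolding F_def using cL LS by blast
  moreover have "L \<inter> V \<noteq> {}" if "V \<in> \<U>" for V using y[OF that] that unfolding L_def by blast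
  ultimately show ?thesis using LS by (intro bexI[of _ L]) auto
qed

text \<open>A given \<open>L\<close> in the box decides how each \<open>m\<close> is handled off
  \<open>K\<close>. If \<open>L\<close> misses \<open>W m\<close>, then \<open>L\<close> meets all
  of \<open>h m\<close>, so \<open>topspace E - U\<close> is not in \<open>h m\<close>, not even
  after adding \<open>K\<close>. If \<open>L\<close> meets \<open>W m\<close>, regularity of the
  marker and thickness of \<open>X\<close> leave a point of \<open>U \<inter> W m\<close> outside
  \<open>K\<close>.\<close>

lemma thin_hits_small:
  assumes K: "K \<in> I"
  shows "thin_in (vietoris E) F (hits E K)"
proof (rule thin_in_vietorisI)
  show "closedin (vietoris E) (hits E K)" using I_closed[OF K] by (rule closedin_vietoris_hits)
  fix U \<U> L assume U: "openin E U" and \<U>: "finite \<U>" "\<And>V. V \<in> \<U> \<Longrightarrow> openin E V"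
    and L: "L \<in> F" "L \<in> vbox E U \<U>"
  have LU: "L \<subseteq> U" "\<And>V. V \<in> \<U> \<Longrightarrow> L \<inter> V \<noteq> {}" using L(2) unfolding vbox_def by auto
  have LF: "L \<subseteq> S" "L \<inter> X \<noteq> {}" "\<And>n. L \<inter> W n \<noteq> {} \<or> (\<forall>M\<in>h n. L \<inter> M \<noteq> {})"
    using L(1) unfolding F_def by auto
  have "\<exists>L'\<in>F. L' \<subseteq> U - K \<and> (\<forall>V\<in>\<U>. L' \<inter> V \<noteq> {})"
  proof (rule F_avoiding[OF U I_closed[OF K] _ _ \<U>(1)])
    show "\<not> U \<inter> X \<subseteq> K" using X_thick[OF U _ K] LF(2) LU(1) by blast
    show "\<not> V \<inter> U \<inter> S \<subseteq> K" if "V \<in> \<U>" for V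
      using S_thick[OF _ _ K, of "V \<inter> U"] U \<U>(2)[OF that] LU(2)[OF that] LF(1) LU(1) by blast
    fix m
    show "\<not> U \<inter> W m \<subseteq> K \<or> (\<exists>L. closedin E L \<and> L \<subseteq> S \<inter> U - K \<and> (\<forall>M\<in>h m. L \<inter> M \<noteq> {}))"
    proof (cases "L \<inter> W m = {}")
      case True
      then have hit: "\<And>M. M \<in> h m \<Longrightarrow> L \<inter> M \<noteq> {}" using LF(3) by blast
      have "topspace E - U \<notin> h m" using hit[of "topspace E - U"] LU(1) by blast
      then have "(topspace E - U) \<union> K \<notin> h m" using U by (intro good_Un[OF h_good _ _ K]) auto
      then show ?thesis using good_hitting[OF h_good S h_S U I_closed[OF K]] by metis
    next
      case False
      then have "U \<inter> W m \<noteq> {}" using LU(1) by blast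
      then obtain V where "openin E V" "V \<subseteq> U" "V \<inter> X \<noteq> {}" "V \<inter> X \<subseteq> W m"
        using W_regular[OF U] by metis
      then show ?thesis using X_thick[of V K] K by blast
    qed
  qed
  then obtain L' where L': "L' \<in> F" "L' \<subseteq> U - K" "\<forall>V\<in>\<U>. L' \<inter> V \<noteq> {}" by blast
  then have "closedin E L'" unfolding F_def by blast
  moreover have "L' \<subseteq> U" "L' \<inter> K = {}" using L'(2) by auto
  ultimately have "L' \<in> vbox E U \<U>" "L' \<notin> hits E K"
    using L'(3) by (simp_all add: vbox_def hits_def compacts_iff)
  then show "\<exists>L'\<in>F. L' \<in> vbox E U \<U> \<and> L' \<notin> hits E K" using L'(1) by blast
qed

text \<open>Pick a late \<open>n\<close> with \<open>h n\<close> a family containing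
  \<open>K\<close> and shrink \<open>U\<close> to \<open>U - W n\<close>: members of
  \<open>F\<close> there miss \<open>W n\<close>, so they meet every set of \<open>h n\<close>,
  among them \<open>K\<close>. What remains is to show that such members exist, that is, to avoid
  \<open>Q = W n\<close>.\<close>

lemma hits_large:
  assumes K: "closedin E K" "K \<subseteq> S" "K \<notin> I" "K \<subseteq> U" and U: "openin E U"
    and \<U>: "finite \<U>" "\<And>V. V \<in> \<U> \<Longrightarrow> openin E V" and L: "L \<in> F" "L \<in> vbox E U \<U>"
  shows "\<exists>Q. openin (vietoris E) Q \<and> Q \<inter> F \<noteq> {} \<and> Q \<inter> F \<subseteq> vbox E U \<U> \<inter> hits E K"
proof -
  have LU: "L \<subseteq> U" "\<And>V. V \<in> \<U> \<Longrightarrow> L \<inter> V \<noteq> {}" using L(2) unfolding vbox_def by auto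
  have LF: "L \<subseteq> S" "L \<inter> X \<noteq> {}" "\<And>n. L \<inter> W n \<noteq> {} \<or> (\<forall>M\<in>h n. L \<inter> M \<noteq> {})"
    using L(1) unfolding F_def by auto
  have UX: "U \<inter> X \<noteq> {}" using LU(1) LF(2) by blast
  obtain m0 T where T: "K \<in> h m0" "closedin E T" "T \<subseteq> U \<inter> S" "\<And>M. M \<in> h m0 \<Longrightarrow> M \<inter> T \<in> h m0"
    using h_local[OF K(1-3) U K(4)] by blast
  obtain N where N: "\<And>m n. \<lbrakk>N \<le> m; N \<le> n; m \<noteq> n\<rbrakk> \<Longrightarrow> \<not> U \<inter> W m \<subseteq> W n"
    using W_separated[OF U UX] by metis
  have e1: "\<forall>\<^sub>F n in sequentially. \<not> U \<inter> X \<subseteq> W n" by (rule W_thin[OF U UX])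
  have e2: "\<forall>\<^sub>F n in sequentially. \<forall>V\<in>\<U>. \<not> V \<inter> U \<inter> S \<subseteq> W n"
  proof (rule eventually_ball_finite[OF \<U>(1)], intro ballI)
    fix V assume V: "V \<in> \<U>"
    show "\<forall>\<^sub>F n in sequentially. \<not> V \<inter> U \<inter> S \<subseteq> W n"
    proof (cases "V \<inter> U \<inter> X = {}")
      case True
      have "V \<inter> U \<inter> S \<noteq> {}" using LU V LF(1) by blast
      then have "\<not> V \<inter> U \<inter> S \<subseteq> W n" for n using True W_X[of n] by blast
      then show ?thesis by simp
    next
      case False
      have "\<forall>\<^sub>F n in sequentially. \<not> V \<inter> U \<inter> X \<subseteq> W n"
        using W_thin[of "V \<inter> U"] U \<U>(2)[OF V] False by blast
      then show ?thesis by (rule eventually_mono) (use X(2) in blast)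
    qed
  qed
  have e3: "\<forall>\<^sub>F n in sequentially. \<forall>m\<in>{..<N}. \<not> U \<inter> W m \<subseteq> W n \<or> (topspace E - U) \<union> W n \<notin> h m"
  proof (rule eventually_ball_finite, simp, intro ballI)
    fix m
    show "\<forall>\<^sub>F n in sequentially. \<not> U \<inter> W m \<subseteq> W n \<or> (topspace E - U) \<union> W n \<notin> h m"
    proof (cases "L \<inter> W m = {}")
      case True
      then have hit: "\<And>M. M \<in> h m \<Longrightarrow> L \<inter> M \<noteq> {}" using LF(3) by blast
      have "topspace E - U \<notin> h m" using hit[of "topspace E - U"] LU(1) by blast
      then have "\<forall>\<^sub>F n in sequentially. (topspace E - U) \<union> W n \<notin> h m"
        using U by (intro W_negligible) auto
      then show ?thesis by (rule eventually_mono) simp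
    next
      case False
      then have "U \<inter> W m \<noteq> {}" using LU(1) by blast
      then obtain V where V: "openin E V" "V \<subseteq> U" "V \<inter> X \<noteq> {}" "V \<inter> X \<subseteq> W m"
        using W_regular[OF U] by metis
      show ?thesis by (rule eventually_mono[OF W_thin[OF V(1,3)]]) (use V in blast)
    qed
  qed
  \<comment> \<open>This is negligibility with \<open>C = {}\<close>, which belongs to no good
    family.\<close>
  have e4: "\<forall>\<^sub>F n in sequentially. W n \<notin> h m0"
    using W_negligible[of "{}" m0] good_empty[OF h_good] by simp
  have "\<forall>\<^sub>F n in sequentially. N \<le> n \<and> \<not> U \<inter> X \<subseteq> W n \<and> (\<forall>V\<in>\<U>. \<not> V \<inter> U \<inter> S \<subseteq> W n) \<and>
      (\<forall>m\<in>{..<N}. \<not> U \<inter> W m \<subseteq> W n \<or> (topspace E - U) \<union> W n \<notin> h m) \<and> W n \<notin> h m0"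
    using e1 e2 e3 e4 eventually_ge_at_top[of N] by (intro eventually_conj)
  from frequently_ex[OF frequently_eventually_frequently[OF h_repeat[of m0] this]]
  obtain n where n': "h n = h m0" "N \<le> n \<and> \<not> U \<inter> X \<subseteq> W n \<and> (\<forall>V\<in>\<U>. \<not> V \<inter> U \<inter> S \<subseteq> W n) \<and>
      (\<forall>m\<in>{..<N}. \<not> U \<inter> W m \<subseteq> W n \<or> (topspace E - U) \<union> W n \<notin> h m) \<and> W n \<notin> h m0"
    by (elim exE conjE) (rule that, assumption, intro conjI)
  have n: "h n = h m0" "N \<le> n" "\<not> U \<inter> X \<subseteq> W n" "\<And>V. V \<in> \<U> \<Longrightarrow> \<not> V \<inter> U \<inter> S \<subseteq> W n"
      "\<And>m. m < N \<Longrightarrow> \<not> U \<inter> W m \<subseteq> W n \<or> (topspace E - U) \<union> W n \<notin> h m" "W n \<notin> h m0"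
    using n' by simp_all
  have "\<exists>L'\<in>F. L' \<subseteq> U - W n \<and> (\<forall>V\<in>\<U>. L' \<inter> V \<noteq> {})"
  proof (rule F_avoiding[OF U W_closed n(3) _ \<U>(1) n(4)])
    fix m
    consider "m = n" | "N \<le> m" "m \<noteq> n" | "m < N" by linarith
    then show "\<not> U \<inter> W m \<subseteq> W n \<or> (\<exists>L. closedin E L \<and> L \<subseteq> S \<inter> U - W n \<and> (\<forall>M\<in>h m. L \<inter> M \<noteq> {}))"
    proof cases
      case 1
      have "(topspace E - topspace E) \<union> W n \<notin> h m0" using n(6) by simp
      then obtain L where "closedin E L" "L \<subseteq> T \<inter> topspace E - W n" "\<And>M. M \<in> h m0 \<Longrightarrow> L \<inter> M \<noteq> {}"
        using good_hitting[OF h_good T(2,4) openin_topspace W_closed] by metis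
      moreover from this(2) have "L \<subseteq> S \<inter> U - W n" using T(3) by blast
      ultimately show ?thesis unfolding 1 n(1) by (intro disjI2 exI[of _ L] conjI ballI)
    next
      case 2
      then show ?thesis using N n(2) by blast
    next
      case 3
      show ?thesis
      proof (cases "U \<inter> W m \<subseteq> W n")
        case True
        then have "(topspace E - U) \<union> W n \<notin> h m" using n(5)[OF 3] by blast
        then show ?thesis using good_hitting[OF h_good S h_S U W_closed] by metis
      qed simp
    qed
  qed
  then obtain L' where L': "L' \<in> F" "L' \<subseteq> U - W n" "\<forall>V\<in>\<U>. L' \<inter> V \<noteq> {}" by blast
  let ?Q = "vbox E (U - W n) \<U>"
  have "openin (vietoris E) ?Q"
    using U W_closed \<U> by (intro openin_vbox) (auto intro: openin_diff)
  moreover have "L' \<in> ?Q" using L' by (simp add: vbox_def compacts_iff F_def)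
  moreover have "?Q \<inter> F \<subseteq> vbox E U \<U> \<inter> hits E K"
  proof
    fix A assume A: "A \<in> ?Q \<inter> F"
    then have "A \<inter> W n = {}" unfolding vbox_def by blast
    then have "\<forall>M\<in>h n. A \<inter> M \<noteq> {}" using A unfolding F_def by blast
    then have "A \<inter> K \<noteq> {}" using T(1) n(1) by blast
    then show "A \<in> vbox E U \<U> \<inter> hits E K" using A unfolding vbox_def hits_def by blast
  qed
  ultimately show ?thesis using L'(1) by blast
qed

lemma covered_iff_meager: "countably_covered_by I (G \<inter> S) \<longleftrightarrow> hits_meager_in E F G"
proof
  assume c: "countably_covered_by I (G \<inter> S)"
  show "hits_meager_in E F G"
    by (rule meager_of_covered[OF closedin_F _ thin_hits_small c]) (auto simp: F_def)
next
  assume "hits_meager_in E F G"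
  moreover have "hits E (G \<inter> S) \<inter> F = hits E G \<inter> F" unfolding hits_def F_def by blast
  ultimately have m: "hits_meager_in E F (G \<inter> S)" unfolding hits_meager_in_def by simp
  show "countably_covered_by I (G \<inter> S)"
  proof (rule covered_of_meager[OF closedin_F S S_in_F _ _ _ m])
    show "insert y L \<in> F" if "L \<in> F" "y \<in> S" for L y
    proof (rule F_up[OF that(1)])
      have "closedin E L" "L \<subseteq> S" using that(1) unfolding F_def by auto
      moreover have "closedin E {y}" using that(2) S closedin_subset closedin_singleton by blast
      ultimately show "closedin E (insert y L)" "insert y L \<subseteq> S"
        using that(2) closedin_Un[of E "{y}" L] by auto
    qed blast
  next
    fix K n ns assume K: "closedin E K" "K \<subseteq> S" "K \<notin> I" "K \<subseteq> b n"
      and "F \<inter> vbox E (b n) (b ` set ns) \<noteq> {}"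
    then obtain L where "L \<in> F" "L \<in> vbox E (b n) (b ` set ns)" by blast
    then show "\<exists>W. openin (vietoris E) W \<and> W \<inter> F \<noteq> {} \<and> W \<inter> F \<subseteq> vbox E (b n) (b ` set ns) \<inter> hits E K"
      using open_b by (intro hits_large[OF K]) auto
  qed simp
qed

end

section \<open>Countable bases of compact metrizable spaces\<close>

lemma separable_metrizable_imp_second_countable:
  assumes "metrizable_space X" "separable_space X"
  shows "second_countable X"
proof -
  obtain M d where "Metric_space M d" and X: "X = Metric_space.mtopology M d"
    using assms(1) unfolding metrizable_space_def by metis
  then interpret Metric_space M d by simp
  obtain C where C: "countable C" "C \<subseteq> M" "X closure_of C = M"
    using assms(2) unfolding separable_space_def X by auto
  let ?B = "(\<lambda>(c, n). mball c (inverse (real (Suc n)))) ` (C \<times> UNIV)"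
  have "countable ?B" using C(1) by simp
  moreover have "openin X V" if "V \<in> ?B" for V using that unfolding X by auto
  moreover have "\<exists>V\<in>?B. x \<in> V \<and> V \<subseteq> U" if U: "openin X U" "x \<in> U" for U x
  proof -
    obtain r where r: "r > 0" "mball x r \<subseteq> U" using U unfolding X openin_mtopology by blast
    have x: "x \<in> M" using U openin_subset unfolding X by fastforce
    obtain n where n: "inverse (real (Suc n)) < r / 2"
      using reals_Archimedean[of "r / 2"] r(1) by auto
    have "x \<in> X closure_of C" using x C(3) by simp
    moreover have "openin X (mball x (inverse (real (Suc n))))" unfolding X by simp
    moreover have "x \<in> mball x (inverse (real (Suc n)))" using x by simp
    ultimately obtain c where c: "c \<in> C" "c \<in> mball x (inverse (real (Suc n)))"
      unfolding in_closure_of by blast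
    have "mball c (inverse (real (Suc n))) \<subseteq> mball x r"
    proof
      fix y assume y: "y \<in> mball c (inverse (real (Suc n)))"
      have "d x y \<le> d x c + d c y" using x y by (intro triangle) auto
      also have "\<dots> < r" using c(2) y n by auto
      finally show "y \<in> mball x r" using x y by auto
    qed
    moreover have "x \<in> mball c (inverse (real (Suc n)))" using c(2) by (auto simp: commute)
    ultimately show ?thesis using r(2) c(1) by blast
  qed
  ultimately show ?thesis unfolding second_countable_def by (intro exI[of _ ?B] conjI ballI allI impI) simp_all
qed

text \<open>Finite unions of sets of a countable base: a compact set in \<open>U\<close> is covered
  by finitely many base sets with closures inside \<open>U\<close>, and the closure of a finite
  union is the union of the closures.\<close>

lemma compact_base_exists:
  assumes E: "compact_space E" "Hausdorff_space E" "second_countable E"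
  obtains b where "compact_base E b"
proof -
  obtain \<B> where \<B>: "countable \<B>" "\<And>V. V \<in> \<B> \<Longrightarrow> openin E V"
    "\<And>U x. \<lbrakk>openin E U; x \<in> U\<rbrakk> \<Longrightarrow> \<exists>V\<in>\<B>. x \<in> V \<and> V \<subseteq> U"
    using E(3) unfolding second_countable_def by auto
  let ?F = "Collect (\<lambda>\<A>. finite \<A> \<and> \<A> \<subseteq> \<B>)"
  define b where "b = from_nat_into (Union ` ?F)"
  have cF: "countable (Union ` ?F)" using countable_Collect_finite_subset[OF \<B>(1)] by simp
  have neF: "Union ` ?F \<noteq> {}" by blast
  have "compact_base E b"
  proof
    fix n
    have "b n \<in> Union ` ?F" unfolding b_def using neF by (rule from_nat_into)
    then obtain \<A> where "b n = \<Union>\<A>" "\<A> \<subseteq> \<B>" by auto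
    then show "openin E (b n)" using \<B>(2) by (simp add: openin_Union subset_iff)
  next
    fix K U assume K: "closedin E K" and U: "openin E U" "K \<subseteq> U"
    have reg: "regular_space E" using E compact_Hausdorff_imp_regular_space by blast
    have ex: "\<exists>V\<in>\<B>. x \<in> V \<and> E closure_of V \<subseteq> U" if x: "x \<in> K" for x
    proof -
      have "x \<in> topspace E - (topspace E - U)" using x U openin_subset by blast
      moreover have "closedin E (topspace E - U)" using U by blast
      ultimately obtain V where V: "openin E V" "x \<in> V" "disjnt (topspace E - U) (E closure_of V)"
        using reg unfolding regular_space by blast
      then obtain B where B: "B \<in> \<B>" "x \<in> B" "B \<subseteq> V" using \<B>(3) by blast
      have "E closure_of B \<subseteq> E closure_of V" using B(3) by (rule closure_of_mono)
      also have "\<dots> \<subseteq> U" using V(3) closure_of_subset_topspace[of E V] by (auto simp: disjnt_iff)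
      finally show ?thesis using B by blast
    qed
    have "compactin E K" using K E(1) closedin_compact_space by blast
    moreover have "K \<subseteq> \<Union>{V \<in> \<B>. E closure_of V \<subseteq> U}" using ex by blast
    moreover have "\<And>V. V \<in> {V \<in> \<B>. E closure_of V \<subseteq> U} \<Longrightarrow> openin E V" using \<B>(2) by blast
    ultimately obtain \<A> where \<A>: "finite \<A>" "\<A> \<subseteq> {V \<in> \<B>. E closure_of V \<subseteq> U}" "K \<subseteq> \<Union>\<A>"
      by (meson compactinD)
    then have "\<A> \<in> ?F" by auto
    then have "\<Union>\<A> \<in> Union ` ?F" by (rule imageI)
    then have "\<exists>n. b n = \<Union>\<A>" unfolding b_def by (rule from_nat_into_surj[OF cF])
    then obtain n where n: "b n = \<Union>\<A>" by (elim exE)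
    have "E closure_of \<Union>\<A> = (\<Union>V\<in>\<A>. E closure_of V)" using \<A>(1) by (rule closure_of_Union)
    then have "E closure_of b n \<subseteq> U" unfolding n using \<A>(2) by auto
    then show "\<exists>n. K \<subseteq> b n \<and> E closure_of b n \<subseteq> U" using n \<A>(3) by metis
  qed (use E in auto)
  then show thesis by (rule that)
qed

section \<open>Countable covers by members of a family\<close>

lemma countably_covered_subset: "\<lbrakk>countably_covered_by I B; A \<subseteq> B\<rbrakk> \<Longrightarrow> countably_covered_by I A"
  unfolding countably_covered_by_def by (meson subset_trans)

lemma countably_covered_member: "K \<in> I \<Longrightarrow> countably_covered_by I K"
  unfolding countably_covered_by_def by (intro exI[of _ "{K}"]) simp

lemma countably_covered_UN:
  assumes "countable J" "\<And>j. j \<in> J \<Longrightarrow> countably_covered_by I (A j)"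
  shows "countably_covered_by I (\<Union>j\<in>J. A j)"
proof -
  obtain c where c: "\<And>j. j \<in> J \<Longrightarrow> countable (c j) \<and> c j \<subseteq> I \<and> A j \<subseteq> \<Union>(c j)"
    using assms(2) unfolding countably_covered_by_def by metis
  have "countable (\<Union>j\<in>J. c j)" by (rule countable_UN[OF assms(1)]) (simp add: c)
  moreover have "(\<Union>j\<in>J. c j) \<subseteq> I" using c by (simp add: UN_least)
  moreover have "(\<Union>j\<in>J. A j) \<subseteq> \<Union>(\<Union>j\<in>J. c j)"
  proof
    fix x assume "x \<in> (\<Union>j\<in>J. A j)"
    then obtain j where j: "j \<in> J" "x \<in> A j" by blast
    then have "x \<in> \<Union>(c j)" using c[OF j(1)] by (meson subsetD)
    then show "x \<in> \<Union>(\<Union>j\<in>J. c j)" using j(1) by blast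
  qed
  ultimately show ?thesis unfolding countably_covered_by_def by blast
qed

lemma countably_covered_Un:
  assumes "countably_covered_by I A" "countably_covered_by I B"
  shows "countably_covered_by I (A \<union> B)"
proof -
  have "countably_covered_by I (\<Union>j\<in>{True, False}. if j then A else B)"
    using assms by (intro countably_covered_UN) auto
  then show ?thesis by (simp add: Un_commute)
qed

context gdelta_ideal
begin

section \<open>Existence of the representing family\<close>

text \<open>Upward closure is relative to \<open>S\<close>; for \<open>S = topspace E\<close> it
  becomes the full one.\<close>

definition represents :: "'a set \<Rightarrow> 'a set set \<Rightarrow> bool" where
  "represents S F \<longleftrightarrow> closedin (vietoris E) F \<and>
     (\<forall>K\<in>F. \<forall>L. closedin E L \<longrightarrow> K \<subseteq> L \<longrightarrow> L \<subseteq> S \<longrightarrow> L \<in> F) \<and>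
     (\<forall>G. countably_covered_by I (G \<inter> S) \<longleftrightarrow> hits_meager_in E F G)"

text \<open>Equivalently, every member of \<open>I\<close> has nowhere dense trace on
  \<open>S\<close>. The empty set is thick, so the reduction also covers an \<open>E\<close> that is
  itself a countable union of members of \<open>I\<close>.\<close>

definition thick :: "'a set \<Rightarrow> bool" where
  "thick S \<longleftrightarrow> closedin E S \<and> (\<forall>U K. openin E U \<longrightarrow> U \<inter> S \<noteq> {} \<longrightarrow> K \<in> I \<longrightarrow> \<not> U \<inter> S \<subseteq> K)"

definition null_dense :: "'a set \<Rightarrow> bool" where
  "null_dense X \<longleftrightarrow> (\<forall>U. openin E U \<longrightarrow> U \<inter> X \<noteq> {} \<longrightarrow> (\<exists>x\<in>U \<inter> X. {x} \<in> I))"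

lemma represents_with_kernel:
  assumes S: "thick S" and X: "thick X" "null_dense X" "X \<subseteq> S" "X \<noteq> {}"
  shows "\<exists>F. represents S F"
proof -
  have cS: "closedin E S" and cX: "closedin E X" using S X(1) unfolding thick_def by auto
  have St: "\<And>U K. \<lbrakk>openin E U; U \<inter> S \<noteq> {}; K \<in> I\<rbrakk> \<Longrightarrow> \<not> U \<inter> S \<subseteq> K"
    using S unfolding thick_def by simp
  have Xt: "\<And>U K. \<lbrakk>openin E U; U \<inter> X \<noteq> {}; K \<in> I\<rbrakk> \<Longrightarrow> \<not> U \<inter> X \<subseteq> K"
    using X(1) unfolding thick_def by simp
  have Xd: "\<And>U. \<lbrakk>openin E U; U \<inter> X \<noteq> {}\<rbrakk> \<Longrightarrow> \<exists>x\<in>U \<inter> X. {x} \<in> I"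
    using X(2) unfolding null_dense_def by simp
  obtain \<H> where \<H>: "countable \<H>" "\<And>H. H \<in> \<H> \<Longrightarrow> good H"
    "\<And>K. closedin E K \<Longrightarrow> K \<notin> I \<Longrightarrow> \<exists>H\<in>\<H>. K \<in> H" using good_cover by metis
  have "X \<subseteq> topspace E" using cX closedin_subset by blast
  then have "topspace E \<inter> X \<noteq> {}" using X(4) by blast
  then have "X \<notin> I" using Xt[OF openin_topspace, of X] by blast
  then have ne: "\<H> \<noteq> {}" using \<H>(3)[OF cX] by blast
  \<comment> \<open>Cutting with base closures provides the local versions of each family; cutting
    with \<open>S\<close> makes every one of them depend only on traces on \<open>S\<close>.\<close>
  define r where "r = (\<lambda>(H, k). {M. closedin E M \<and> M \<inter> (E closure_of b k \<inter> S) \<in> H})"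
  let ?R = "r ` (\<H> \<times> UNIV)"
  \<comment> \<open>The second component of the decoded pair is a dummy, so each family is listed
    infinitely often.\<close>
  define h where "h n = from_nat_into ?R (fst (prod_decode n))" for n
  have R: "countable ?R" "?R \<noteq> {}" using \<H>(1) ne by auto
  have hR: "h n \<in> ?R" for n unfolding h_def using R(2) by (rule from_nat_into)
  have h_ex: "\<exists>H\<in>\<H>. \<exists>k. h n = {M. closedin E M \<and> M \<inter> (E closure_of b k \<inter> S) \<in> H}" for n
    using hR[of n] unfolding r_def by auto
  have h_good: "good (h n)" for n
  proof -
    obtain H k where "H \<in> \<H>" "h n = {M. closedin E M \<and> M \<inter> (E closure_of b k \<inter> S) \<in> H}"
      using h_ex by metis
    then show ?thesis using good_restrict[OF \<H>(2), of H "E closure_of b k \<inter> S"] cS by (simp add: closedin_Int)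
  qed
  obtain W :: "nat \<Rightarrow> 'a set" where W: "\<And>n. closedin E (W n)" "\<And>n. W n \<subseteq> X"
    "\<And>n U. \<lbrakk>openin E U; U \<inter> W n \<noteq> {}\<rbrakk> \<Longrightarrow> \<exists>V. openin E V \<and> V \<subseteq> U \<and> V \<inter> X \<noteq> {} \<and> V \<inter> X \<subseteq> W n"
    "\<And>i m. \<lbrakk>b i \<inter> X \<noteq> {}; i \<le> m\<rbrakk> \<Longrightarrow> \<exists>z\<in>b i \<inter> W m. \<forall>n\<ge>i. n \<noteq> m \<longrightarrow> z \<notin> W n"
    "\<And>k l n. \<lbrakk>E closure_of b k \<notin> h l; k \<le> n; l \<le> n\<rbrakk> \<Longrightarrow> E closure_of b k \<union> W n \<notin> h l"
    by (rule separating_sequence[OF cX Xt Xd h_good]) (assumption | rule that)+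
  interpret separated_kernel E b I S X h W
  proof
    fix M n assume M: "M \<in> h n"
    obtain H k where hn: "h n = {M. closedin E M \<and> M \<inter> (E closure_of b k \<inter> S) \<in> H}"
      using h_ex by metis
    have "M \<inter> S \<inter> (E closure_of b k \<inter> S) = M \<inter> (E closure_of b k \<inter> S)" by blast
    then show "M \<inter> S \<in> h n" using M cS unfolding hn by (simp add: closedin_Int)
  next
    fix K U assume K: "closedin E K" "K \<subseteq> S" "K \<notin> I" and U: "openin E U" "K \<subseteq> U"
    obtain H where H: "H \<in> \<H>" "K \<in> H" using \<H>(3)[OF K(1,3)] by blast
    obtain k where k: "K \<subseteq> b k" "E closure_of b k \<subseteq> U" using base[OF K(1) U] by blast
    let ?T = "E closure_of b k \<inter> S"
    have "r (H, k) \<in> ?R" using H(1) by blast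
    then obtain i where i: "from_nat_into ?R i = r (H, k)" using from_nat_into_surj[OF R(1)] by metis
    define m where "m = prod_encode (i, 0)"
    have hm: "h m = {M. closedin E M \<and> M \<inter> ?T \<in> H}"
      unfolding h_def m_def prod_encode_inverse fst_conv i by (simp add: r_def)
    have "K \<inter> ?T = K" using k(1) b_subset_closure[of k] K(2) by blast
    then have "K \<in> h m" unfolding hm using K(1) H(2) by simp
    moreover have cT: "closedin E ?T" using cS by (simp add: closedin_Int)
    moreover have "M \<inter> ?T \<in> h m" if "M \<in> h m" for M
    proof -
      have "M \<inter> ?T \<inter> ?T = M \<inter> ?T" by blast
      then show ?thesis using that cT unfolding hm by (simp add: closedin_Int)
    qed
    ultimately show "\<exists>m T. K \<in> h m \<and> closedin E T \<and> T \<subseteq> U \<inter> S \<and> (\<forall>M\<in>h m. M \<inter> T \<in> h m)"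
      using k(2) by (intro exI[of _ m] exI[of _ ?T] conjI ballI) auto
  next
    fix m
    show "\<exists>\<^sub>F n in sequentially. h n = h m"
      unfolding frequently_sequentially
    proof
      fix N
      have "h (prod_encode (fst (prod_decode m), N)) = h m" unfolding h_def by simp
      then show "\<exists>n\<ge>N. h n = h m" using le_prod_encode_2 by blast
    qed
  qed (use cS St cX X(3,4) Xt h_good W in simp_all)
  have "represents S F"
    unfolding represents_def using closedin_F F_up covered_iff_meager by auto
  then show ?thesis by blast
qed

section \<open>The case without a kernel\<close>

lemma countably_covered_points:
  assumes "countably_covered_by I G" "x \<in> G"
  shows "{x} \<in> I"
proof -
  obtain K where K: "K \<in> I" "x \<in> K" using assms unfolding countably_covered_by_def by blast
  then have "x \<in> topspace E" using I_closed[OF K(1)] closedin_subset by blast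
  then show ?thesis using I_subset[OF K(1)] closedin_singleton K(2) by blast
qed

text \<open>Delete from \<open>G\<close> all base sets on which it is countably covered. A
  relatively open part of the closure of the remainder inside a member of \<open>I\<close> would
  allow one more deletion, so this closure is thick; it is null-dense because the remainder consists
  of points with singletons in \<open>I\<close>. It is therefore empty.\<close>

lemma covered_without_kernel:
  assumes S: "closedin E S"
    and no: "\<And>X. \<lbrakk>thick X; null_dense X; X \<subseteq> S\<rbrakk> \<Longrightarrow> X = {}"
    and G: "G \<subseteq> S" "\<And>x. x \<in> G \<Longrightarrow> {x} \<in> I"
  shows "countably_covered_by I G"
proof -
  define J where "J = {k. countably_covered_by I (G \<inter> b k)}"
  define G1 where "G1 = G - (\<Union>k\<in>J. b k)"
  have covJ: "countably_covered_by I (\<Union>k\<in>J. G \<inter> b k)"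
    unfolding J_def by (intro countably_covered_UN) auto
  define X where "X = E closure_of G1"
  have GS: "G1 \<subseteq> S" using G(1) unfolding G1_def by blast
  have Gt: "G1 \<subseteq> topspace E" using GS closedin_subset[OF S] by blast
  have meet: "U \<inter> G1 \<noteq> {}" if "openin E U" "U \<inter> X \<noteq> {}" for U
    using that openin_Int_closure_of_eq_empty[OF that(1), of G1] unfolding X_def by blast
  have G1X: "G1 \<subseteq> X" unfolding X_def using Gt by (rule closure_of_subset)
  have "X = {}"
  proof (rule no)
    show "X \<subseteq> S" unfolding X_def using GS S by (rule closure_of_minimal)
    show "thick X"
      unfolding thick_def
    proof (intro conjI allI impI)
      show "closedin E X" unfolding X_def by simp
      fix U K assume U: "openin E U" "U \<inter> X \<noteq> {}" and K: "K \<in> I"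
      show "\<not> U \<inter> X \<subseteq> K"
      proof
        assume sub: "U \<inter> X \<subseteq> K"
        obtain x where x: "x \<in> U" "x \<in> G1" using meet[OF U] by blast
        obtain k where k: "x \<in> b k" "E closure_of b k \<subseteq> U" by (rule base_point[OF U(1) x(1)])
        have "G1 \<inter> b k \<subseteq> K" using sub G1X k(2) b_subset_closure[of k] by blast
        then have "G \<inter> b k \<subseteq> (\<Union>k\<in>J. G \<inter> b k) \<union> K" unfolding G1_def by auto
        then have "countably_covered_by I (G \<inter> b k)"
          using countably_covered_Un[OF covJ countably_covered_member[OF K]] countably_covered_subset by metis
        then have "k \<in> J" unfolding J_def by simp
        then show False using x(2) k(1) unfolding G1_def by blast
      qed
    qed
    show "null_dense X"
      unfolding null_dense_def
    proof (intro allI impI)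
      fix U assume "openin E U" "U \<inter> X \<noteq> {}"
      then obtain x where "x \<in> U" "x \<in> G1" using meet by blast
      then show "\<exists>x\<in>U \<inter> X. {x} \<in> I" using G1X G(2) unfolding G1_def by blast
    qed
  qed
  then have "G1 = {}" using G1X by blast
  then have "G \<subseteq> (\<Union>k\<in>J. G \<inter> b k)" unfolding G1_def by blast
  then show ?thesis using covJ countably_covered_subset by metis
qed

lemma not_meager_of_open:
  assumes F: "closedin (vietoris E) F" and V: "openin (vietoris E) V" "V \<inter> F \<noteq> {}" "V \<inter> F \<subseteq> hits E G"
  shows "\<not> hits_meager_in E F G"
proof
  assume "hits_meager_in E F G"
  then obtain \<N> where \<N>: "countable \<N>" "\<And>N. N \<in> \<N> \<Longrightarrow> thin_in (vietoris E) F N" "hits E G \<inter> F \<subseteq> \<Union>\<N>"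
    using F unfolding hits_meager_in_def by (auto simp: meager_in_subtopology_iff)
  have "closedin (vietoris E) N" if "N \<in> \<N>" for N
    using \<N>(2)[OF that] unfolding thin_in_def by blast
  moreover have "V \<inter> F \<subseteq> \<Union>\<N>" using V(3) \<N>(3) by blast
  ultimately obtain N W where "N \<in> \<N>" "openin (vietoris E) W" "W \<inter> F \<noteq> {}" "W \<inter> F \<subseteq> N"
    using Baire_vietoris[OF F V(1,2) \<N>(1)] by metis
  then show False using \<N>(2) unfolding thin_in_def by blast
qed


text \<open>In the one-point space \<open>{S}\<close> only the empty set is meager.\<close>

lemma represents_singleton:
  assumes S: "closedin E S" and cov: "\<And>G. G \<inter> S \<noteq> {} \<Longrightarrow> \<not> countably_covered_by I (G \<inter> S)"
  shows "represents S {S}"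
proof -
  have "S \<in> topspace (vietoris E)" using S compacts_iff topspace_vietoris by metis
  then have c: "closedin (vietoris E) {S}"
    using Hausdorff_vietoris[OF compact Hausdorff] by (simp add: closedin_Hausdorff_singleton)
  have "countably_covered_by I (G \<inter> S) \<longleftrightarrow> hits_meager_in E {S} G" for G
  proof (cases "G \<inter> S = {}")
    case True
    have "hits E G \<inter> {S} = {}" using True unfolding hits_def by blast
    then have "hits_meager_in E {S} G"
      unfolding hits_meager_in_def meager_in_def by (intro exI[of _ "{}"]) simp
    moreover have "countably_covered_by I {}"
      unfolding countably_covered_by_def by (intro exI[of _ "{}"]) simp
    ultimately show ?thesis using True by simp
  next
    case False
    have "compacts E \<inter> {S} \<noteq> {}" "compacts E \<inter> {S} \<subseteq> hits E G"
      using False S compacts_iff unfolding hits_def by auto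
    moreover have "openin (vietoris E) (compacts E)"
      using openin_topspace[of "vietoris E"] by (simp add: topspace_vietoris)
    ultimately have "\<not> hits_meager_in E {S} G" by (intro not_meager_of_open[OF c])
    then show ?thesis using cov[OF False] by blast
  qed
  then show ?thesis unfolding represents_def using c by auto
qed

text \<open>With \<open>H\<close> running through a countable cover by good families, these closed
  sets exhaust the points of \<open>S\<close> whose singletons are outside \<open>I\<close>.\<close>

lemma closed_good_points:
  assumes S: "closedin E S" and H: "good H"
  shows "closedin E {y \<in> S. {y} \<in> H}"
proof -
  have "openin E {y \<in> topspace E. {y} \<notin> H}"
  proof (subst openin_subopen, intro ballI)
    fix y assume y: "y \<in> {y \<in> topspace E. {y} \<notin> H}"
    then obtain U where U: "openin E U" "{y} \<subseteq> U" "\<And>M. M \<in> H \<Longrightarrow> \<not> M \<subseteq> U"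
      using good_outside[OF H closedin_singleton] by (metis (no_types, lifting) mem_Collect_eq)
    have "{z} \<notin> H" if "z \<in> U" for z using U(3)[of "{z}"] that by blast
    then have "U \<subseteq> {y \<in> topspace E. {y} \<notin> H}" using openin_subset[OF U(1)] by blast
    then show "\<exists>T. openin E T \<and> y \<in> T \<and> T \<subseteq> {y \<in> topspace E. {y} \<notin> H}" using U(1,2) by blast
  qed
  then have "closedin E (S - {y \<in> topspace E. {y} \<notin> H})" using S by (simp add: closedin_diff)
  moreover have "S - {y \<in> topspace E. {y} \<notin> H} = {y \<in> S. {y} \<in> H}"
    using closedin_subset[OF S] by blast
  ultimately show ?thesis by simp
qed

text \<open>Without a kernel, a set is covered iff it avoids the \<open>F_\<sigma>\<close> set \<open>B = {x. {x} \<notin> I}\<close>. Unless \<open>B = S\<close>,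
  points \<open>x n \<in> B\<close> converging to some \<open>a\<close> with \<open>{a} \<in> I\<close> play the role of the markers.\<close>

lemma represents_without_kernel:
  assumes S: "thick S"
    and no: "\<And>X. \<lbrakk>thick X; null_dense X; X \<subseteq> S\<rbrakk> \<Longrightarrow> X = {}"
  shows "\<exists>F. represents S F"
proof -
  have cS: "closedin E S" using S unfolding thick_def by auto
  have St: "\<And>U K. \<lbrakk>openin E U; U \<inter> S \<noteq> {}; K \<in> I\<rbrakk> \<Longrightarrow> \<not> U \<inter> S \<subseteq> K"
    using S unfolding thick_def by simp
  define B where "B = {x \<in> S. {x} \<notin> I}"
  have cov: "countably_covered_by I (G \<inter> S) \<longleftrightarrow> G \<inter> B = {}" for G
  proof
    assume "countably_covered_by I (G \<inter> S)"
    then show "G \<inter> B = {}" using countably_covered_points unfolding B_def by blast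
  next
    assume "G \<inter> B = {}"
    then show "countably_covered_by I (G \<inter> S)"
      by (intro covered_without_kernel[OF cS no]) (auto simp: B_def)
  qed
  show ?thesis
  proof (cases "B = S")
    case True
    have "\<not> countably_covered_by I (G \<inter> S)" if "G \<inter> S \<noteq> {}" for G
      using that cov[of G] True by simp
    then show ?thesis using represents_singleton[OF cS] by blast
  next
    case False
    then obtain a where a: "a \<in> S" "{a} \<in> I" unfolding B_def by blast
    have dense: "U \<inter> B \<noteq> {}" if U: "openin E U" "U \<inter> S \<noteq> {}" for U
    proof
      assume emp: "U \<inter> B = {}"
      \<comment> \<open>If \<open>U\<close> missed \<open>B\<close>, this closure would inherit
        thickness from \<open>S\<close> and be null-dense, a kernel.\<close>
      define X where "X = E closure_of (U \<inter> S)"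
      have "U \<inter> S \<subseteq> topspace E" using closedin_subset[OF cS] by blast
      then have UX: "U \<inter> S \<subseteq> X" unfolding X_def by (rule closure_of_subset)
      have meet: "V \<inter> (U \<inter> S) \<noteq> {}" if "openin E V" "V \<inter> X \<noteq> {}" for V
        using that openin_Int_closure_of_eq_empty[OF that(1), of "U \<inter> S"] unfolding X_def by blast
      have "X = {}"
      proof (rule no)
        show "X \<subseteq> S" unfolding X_def using cS by (intro closure_of_minimal) auto
        show "thick X"
          unfolding thick_def
        proof (intro conjI allI impI)
          show "closedin E X" unfolding X_def by simp
          fix V K assume V: "openin E V" "V \<inter> X \<noteq> {}" and K: "K \<in> I"
          have "V \<inter> U \<inter> S \<noteq> {}" using meet[OF V] by blast
          then have "\<not> V \<inter> U \<inter> S \<subseteq> K" using St[OF _ _ K] V(1) U(1) by blast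
          then show "\<not> V \<inter> X \<subseteq> K" using UX by blast
        qed
        show "null_dense X"
          unfolding null_dense_def
        proof (intro allI impI)
          fix V assume "openin E V" "V \<inter> X \<noteq> {}"
          then obtain x where "x \<in> V" "x \<in> U" "x \<in> S" using meet by blast
          then show "\<exists>x\<in>V \<inter> X. {x} \<in> I" using UX emp unfolding B_def by blast
        qed
      qed
      then show False using UX U(2) by blast
    qed
    have at: "a \<in> topspace E" using a(1) closedin_subset[OF cS] by blast
    have "\<exists>y. y \<in> B \<and> (\<forall>k\<le>n. a \<in> b k \<longrightarrow> y \<in> b k)" for n
    proof -
      let ?V = "(\<Inter>k\<in>{k. k \<le> n \<and> a \<in> b k}. b k) \<inter> topspace E"
      have "openin E ?V" using open_b by (intro openin_INT) auto
      moreover have "a \<in> ?V \<inter> S" using a(1) at by blast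
      ultimately have "?V \<inter> B \<noteq> {}" using dense by blast
      then show ?thesis by blast
    qed
    then obtain x where x: "\<And>n. x n \<in> B" "\<And>n k. \<lbrakk>k \<le> n; a \<in> b k\<rbrakk> \<Longrightarrow> x n \<in> b k" by metis
    have conv: "\<exists>N. \<forall>n\<ge>N. x n \<in> U" if U: "openin E U" "a \<in> U" for U
    proof -
      obtain k where k: "a \<in> b k" "E closure_of b k \<subseteq> U" by (rule base_point[OF U])
      then have "\<forall>n\<ge>k. x n \<in> U" using x(2) b_subset_closure[of k] by blast
      then show ?thesis by blast
    qed
    have lim: "limitin E x a sequentially"
      unfolding limitin_def eventually_sequentially using at conv by blast
    have xS: "x n \<in> S" "x n \<noteq> a" for n using x(1)[of n] a(2) unfolding B_def by auto
    have xt: "x n \<in> topspace E" for n using xS(1) closedin_subset[OF cS] by blast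
    have ins: "closedin E (insert a T)" if "T \<subseteq> range x" for T
    proof -
      have "compactin E (insert a T)"
        using lim that xt by (intro compactin_sequence_with_limit) auto
      then show ?thesis using Hausdorff compactin_imp_closedin by blast
    qed
    define Y where "Y = insert a (range x)"
    have cY: "closedin E Y" unfolding Y_def by (rule ins) simp
    \<comment> \<open>Unlike the markers in the kernel case, these finite sets increase. Containing
      \<open>x m\<close> settles all conditions with \<open>j \<ge> m\<close> at once, and each
      \<open>W j\<close> can be avoided, because the \<open>x m\<close> converge to
      \<open>a\<close>, which is not in \<open>W j\<close>.\<close>
    define W where "W j = x ` {..j}" for j :: nat
    have cW: "closedin E (W j)" for j
    proof -
      have "closedin E (\<Union>i\<in>{..j}. {x i})" using xt closedin_singleton by (intro closedin_Union) auto
      moreover have "(\<Union>i\<in>{..j}. {x i}) = W j" unfolding W_def by blast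
      ultimately show ?thesis by simp
    qed
    obtain \<H> where \<H>: "countable \<H>" "\<And>H. H \<in> \<H> \<Longrightarrow> good H"
      "\<And>K. closedin E K \<Longrightarrow> K \<notin> I \<Longrightarrow> \<exists>H\<in>\<H>. K \<in> H" using good_cover by metis
    define c where "c = (\<lambda>(H, k). {y \<in> S. {y} \<in> H} \<inter> E closure_of b k)"
    define P where "P = {(H, k). H \<in> \<H> \<and> E closure_of b k \<inter> Y = {}}"
    \<comment> \<open>The empty set makes \<open>R\<close> nonempty, so that it can be enumerated;
      the condition it contributes to \<open>F\<close> is vacuous.\<close>
    define R where "R = insert {} (c ` P)"
    have "P \<subseteq> \<H> \<times> UNIV" unfolding P_def by blast
    then have "countable P" using \<H>(1) by (meson countable_SIGMA countable_subset countableI_type)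
    then have cR: "countable R" unfolding R_def by simp
    define C where "C = from_nat_into R"
    have rC: "range C = R" unfolding C_def using cR by (intro range_from_nat_into) (simp_all add: R_def)
    have C: "closedin E (C j) \<and> C j \<subseteq> B - Y" for j
    proof -
      have "C j \<in> R" using rC by blast
      then consider "C j = {}" | H k where "H \<in> \<H>" "E closure_of b k \<inter> Y = {}"
          "C j = {y \<in> S. {y} \<in> H} \<inter> E closure_of b k"
        unfolding R_def P_def c_def by auto
      then show ?thesis
      proof cases
        case 2
        have "closedin E (C j)" unfolding 2(3)
          by (intro closedin_Int closed_good_points cS \<H>(2) 2(1) closedin_closure_of)
        moreover have "C j \<subseteq> B" unfolding 2(3) B_def using good_disjoint[OF \<H>(2)[OF 2(1)]] by blast
        moreover have "C j \<inter> Y = {}" unfolding 2(3) using 2(2) by blast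
        ultimately show ?thesis by blast
      qed simp
    qed
    have C_ex: "\<exists>j. y \<in> C j" if y: "y \<in> B" "y \<notin> Y" for y
    proof -
      have yt: "y \<in> topspace E" using y(1) closedin_subset[OF cS] unfolding B_def by blast
      have "{y} \<notin> I" using y(1) unfolding B_def by blast
      then obtain H where H: "H \<in> \<H>" "{y} \<in> H" using \<H>(3)[OF closedin_singleton[OF yt]] by blast
      have "y \<in> topspace E - Y" using yt y(2) by blast
      moreover have "openin E (topspace E - Y)" using cY by blast
      ultimately obtain k where k: "y \<in> b k" "E closure_of b k \<subseteq> topspace E - Y"
        using base_point by metis
      have "(H, k) \<in> P" unfolding P_def using H(1) k(2) by blast
      then have "c (H, k) \<in> range C" using rC unfolding R_def by blast
      moreover have "y \<in> c (H, k)"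
        unfolding c_def using H(2) k(1) b_subset_closure[of k] y(1) unfolding B_def by auto
      ultimately show ?thesis by blast
    qed
    define F where "F = {L. closedin E L \<and> L \<subseteq> S \<and> L \<inter> Y \<noteq> {} \<and> (\<forall>j. C j \<subseteq> L \<or> L \<inter> W j \<noteq> {})}"
    have cF: "closedin (vietoris E) F"
    proof -
      let ?A = "\<lambda>j. hits E (W j) \<union> {L \<in> compacts E. \<forall>M\<in>(\<lambda>y. {y}) ` C j. L \<inter> M \<noteq> {}}"
      have sub: "C j \<subseteq> L \<longleftrightarrow> (\<forall>M\<in>(\<lambda>y. {y}) ` C j. L \<inter> M \<noteq> {})" for j L by blast
      have eq: "F = {L \<in> compacts E. L \<subseteq> S} \<inter> hits E Y \<inter> (\<Inter>j. ?A j)"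
        unfolding F_def hits_def compacts_iff sub by (rule set_eqI) (simp, metis)
      have "closedin E {y}" if "y \<in> C j" for y j
        using that C closedin_subset closedin_singleton by blast
      then have "closedin (vietoris E) (?A j)" for j
        using cW by (intro closedin_Un closedin_vietoris_hits closedin_vietoris_hits_all) auto
      then have "closedin (vietoris E) (\<Inter>j. ?A j)" by (intro closedin_INT) auto
      then show ?thesis
        unfolding eq by (intro closedin_Int closedin_vietoris_hits closedin_vietoris_subset cS cY)
    qed
    have F_up: "L \<in> F" if a: "K \<in> F" "closedin E L" "K \<subseteq> L" "L \<subseteq> S" for K L
    proof -
      have *: "K \<inter> A \<noteq> {} \<Longrightarrow> L \<inter> A \<noteq> {}" "A \<subseteq> K \<Longrightarrow> A \<subseteq> L" for A using a(3) by blast+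
      have "C j \<subseteq> L \<or> L \<inter> W j \<noteq> {}" for j
        using a(1) * unfolding F_def by (metis (mono_tags, lifting) mem_Collect_eq)
      then show ?thesis using a * unfolding F_def by blast
    qed
    define D where "D n L = (\<Union>j\<in>{j. j < n \<and> C j \<subseteq> L}. C j)" for n L
    have cD: "closedin E (D n L)" for n L unfolding D_def using C by (intro closedin_Union) auto
    have DL: "D n L \<subseteq> L" "D n L \<subseteq> B - Y" for n L unfolding D_def using C by auto
    have thin: "thin_in (vietoris E) F (hits E K)" if K: "K \<in> I" for K
    proof (rule thin_in_vietorisI)
      show "closedin (vietoris E) (hits E K)" using I_closed[OF K] by (rule closedin_vietoris_hits)
      fix U \<U> L assume U: "openin E U" and \<U>: "finite \<U>" "\<And>V. V \<in> \<U> \<Longrightarrow> openin E V"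
        and L: "L \<in> F" "L \<in> vbox E U \<U>"
      have LU: "L \<subseteq> U" "\<And>V. V \<in> \<U> \<Longrightarrow> L \<inter> V \<noteq> {}" using L(2) unfolding vbox_def by auto
      have LF: "L \<subseteq> S" "L \<inter> Y \<noteq> {}" "\<And>j. C j \<subseteq> L \<or> L \<inter> W j \<noteq> {}"
        using L(1) unfolding F_def by auto
      have KB: "K \<inter> B = {}"
        using countably_covered_points[OF countably_covered_member[OF K]] unfolding B_def by blast
      have "\<exists>m. x m \<in> U"
      proof (cases "a \<in> L")
        case True
        then show ?thesis using conv[OF U] LU(1) by blast
      next
        case False
        then show ?thesis using LF(2) LU(1) unfolding Y_def by blast
      qed
      then obtain m where m: "x m \<in> U" by blast
      have "\<exists>y. y \<in> V \<inter> U \<inter> S - K" if V: "V \<in> \<U>" for V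
      proof -
        have "V \<inter> U \<inter> S \<noteq> {}" using LU(2)[OF V] LU(1) LF(1) by blast
        then show ?thesis using St[OF _ _ K, of "V \<inter> U"] U \<U>(2)[OF V] by blast
      qed
      then obtain y where y: "\<And>V. V \<in> \<U> \<Longrightarrow> y V \<in> V \<inter> U \<inter> S - K" by metis
      \<comment> \<open>The point \<open>x m\<close> settles the conditions with
        \<open>j \<ge> m\<close>. For \<open>j < m\<close> the new set keeps the reason why
        \<open>L\<close> satisfied the condition: a whole \<open>C j\<close>, or a point
        \<open>x i\<close> of \<open>L\<close> with \<open>i \<le> j\<close>. All of this lies in
        \<open>B\<close>, which is disjoint from \<open>K\<close>, and the points \<open>y V\<close>
        were chosen off \<open>K\<close>.\<close>
      define L' where "L' = D m L \<union> (\<Union>z\<in>insert (x m) (x ` {..m} \<inter> L \<union> y ` \<U>). {z})"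
      have fin: "finite (insert (x m) (x ` {..m} \<inter> L \<union> y ` \<U>))" using \<U>(1) by simp
      have sub: "insert (x m) (x ` {..m} \<inter> L \<union> y ` \<U>) \<subseteq> S \<inter> U - K"
        using xS(1) m KB x(1) LF(1) LU(1) y by auto
      have "closedin E (\<Union>z\<in>insert (x m) (x ` {..m} \<inter> L \<union> y ` \<U>). {z})"
      proof (rule closedin_Union)
        show "finite ((\<lambda>z. {z}) ` insert (x m) (x ` {..m} \<inter> L \<union> y ` \<U>))"
          using fin by (rule finite_imageI)
        fix T assume "T \<in> (\<lambda>z. {z}) ` insert (x m) (x ` {..m} \<inter> L \<union> y ` \<U>)"
        then obtain z where "T = {z}" "z \<in> S" using sub by blast
        then show "closedin E T" using closedin_subset[OF cS] closedin_singleton by blast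
      qed
      then have cL': "closedin E L'" unfolding L'_def using cD by (intro closedin_Un)
      have "D m L \<subseteq> S \<inter> U - K" using DL LF(1) LU(1) KB by blast
      then have L'sub: "L' \<subseteq> S \<inter> U - K" unfolding L'_def using sub by blast
      have xm: "x m \<in> L'" unfolding L'_def by blast
      have "C j \<subseteq> L' \<or> L' \<inter> W j \<noteq> {}" for j
      proof (cases "m \<le> j")
        case True
        then have "x m \<in> W j" unfolding W_def by simp
        then show ?thesis using xm by blast
      next
        case False
        show ?thesis
        proof (cases "C j \<subseteq> L")
          case True
          then have "j \<in> {j. j < m \<and> C j \<subseteq> L}" using False by simp
          then have "C j \<subseteq> D m L" unfolding D_def by (rule UN_upper)
          then show ?thesis unfolding L'_def by blast
        next
          case nsub: False
          then obtain i where i: "i \<le> j" "x i \<in> L" using LF(3)[of j] unfolding W_def by auto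
          then have "x i \<in> L'" unfolding L'_def using False by auto
          then show ?thesis using i(1) unfolding W_def by auto
        qed
      qed
      then have "L' \<in> F" unfolding F_def using cL' L'sub xm unfolding Y_def by blast
      moreover have "L' \<inter> V \<noteq> {}" if "V \<in> \<U>" for V
      proof -
        have "y V \<in> L'" unfolding L'_def using that by blast
        then show ?thesis using y[OF that] by blast
      qed
      moreover have "L' \<inter> K = {}" "L' \<subseteq> U" using L'sub by auto
      ultimately show "\<exists>L'\<in>F. L' \<in> vbox E U \<U> \<and> L' \<notin> hits E K"
        using cL' by (intro bexI[of _ L']) (simp_all add: vbox_def hits_def compacts_iff)
    qed
    \<comment> \<open>With \<open>m \<le> n\<close>, adding \<open>x m\<close> to
      \<open>D' n\<close> gives a member of \<open>F\<close>: conditions up to \<open>n\<close> hold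
      by containment, later ones because \<open>x m \<in> W j\<close>. Apart from \<open>x m\<close>
      this member misses \<open>Y\<close>.\<close>
    define D' where "D' n = (\<Union>j\<in>{..n}. C j)" for n
    have cD': "closedin E (insert (x m) (D' n))" for m n
    proof -
      have "closedin E (D' n)" unfolding D'_def using C by (intro closedin_Union) auto
      then have "closedin E ({x m} \<union> D' n)" using closedin_singleton[OF xt] by (intro closedin_Un)
      then show ?thesis by simp
    qed
    have D'B: "D' n \<subseteq> B - Y" for n unfolding D'_def using C by blast
    have inF: "insert (x m) (D' n) \<in> F" if mn: "m \<le> n" for m n
    proof -
      have "insert (x m) (D' n) \<subseteq> S" using D'B xS(1) unfolding B_def by blast
      moreover have "C j \<subseteq> insert (x m) (D' n) \<or> insert (x m) (D' n) \<inter> W j \<noteq> {}" for j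
      proof (cases "j \<le> n")
        case True
        then show ?thesis unfolding D'_def by auto
      next
        case False
        then have "x m \<in> W j" using mn unfolding W_def by simp
        then show ?thesis by blast
      qed
      ultimately show ?thesis unfolding F_def Y_def using cD' by auto
    qed
    have local: "\<exists>V. openin (vietoris E) V \<and> V \<inter> F \<noteq> {} \<and> V \<inter> F \<subseteq> hits E {y}" if y: "y \<in> B" for y
    proof (cases "y \<in> Y")
      case True
      then obtain i where i: "y = x i" using y a(2) unfolding Y_def B_def by blast
      \<comment> \<open>A member of \<open>F\<close> must meet \<open>Y\<close>; if it avoids
        \<open>?T\<close>, the point \<open>x i\<close> is the only one left. Values are removed
        rather than indices, since \<open>x\<close> may repeat.\<close>
      let ?T = "insert a (range x - {x i})"
      let ?V = "vbox E (topspace E - ?T) {}"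
      have cT: "closedin E ?T" by (rule ins) blast
      then have "openin (vietoris E) ?V" by (intro openin_vbox) auto
      moreover have "insert (x i) (D' i) \<in> ?V"
      proof -
        have "?T \<subseteq> Y" "x i \<notin> ?T" using xS(2)[of i] unfolding Y_def by auto
        then have "insert (x i) (D' i) \<subseteq> topspace E - ?T"
          using D'B[of i] closedin_subset[OF cD'] by blast
        then show ?thesis using cD' by (simp add: vbox_def compacts_iff)
      qed
      moreover have "L \<in> hits E {y}" if "L \<in> ?V \<inter> F" for L
      proof -
        have "L \<inter> Y \<noteq> {}" "L \<subseteq> topspace E - ?T" "L \<in> compacts E"
          using that unfolding F_def vbox_def by auto
        moreover have "Y \<subseteq> insert (x i) ?T" unfolding Y_def by blast
        ultimately show ?thesis unfolding hits_def i by blast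
      qed
      ultimately show ?thesis using inF[of i i] by blast
    next
      case False
      then obtain j where j: "y \<in> C j" using C_ex y by blast
      let ?V = "vbox E (topspace E - W j) {}"
      have op: "openin E (topspace E - W j)" using cW by blast
      then have oV: "openin (vietoris E) ?V" by (intro openin_vbox) auto
      have "a \<notin> W j" using xS(2) unfolding W_def by blast
      then obtain m where m: "x m \<in> topspace E - W j" using conv[OF op] at by blast
      have "W j \<subseteq> Y" unfolding W_def Y_def by blast
      then have "insert (x m) (D' m) \<subseteq> topspace E - W j"
        using m D'B[of m] closedin_subset[OF cD'] by blast
      then have "insert (x m) (D' m) \<in> ?V" using cD' by (simp add: vbox_def compacts_iff)
      moreover have "L \<in> hits E {y}" if "L \<in> ?V \<inter> F" for L
      proof -
        have "L \<inter> W j = {}" "L \<in> compacts E" "C j \<subseteq> L \<or> L \<inter> W j \<noteq> {}"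
          using that unfolding F_def vbox_def by auto
        then show ?thesis using j unfolding hits_def by blast
      qed
      ultimately show ?thesis using inF[of m m] oV by blast
    qed
    have "countably_covered_by I (G \<inter> S) \<longleftrightarrow> hits_meager_in E F G" for G
    proof
      assume "countably_covered_by I (G \<inter> S)"
      then show "hits_meager_in E F G"
        using thin by (intro meager_of_covered[OF cF]) (auto simp: F_def)
    next
      assume meag: "hits_meager_in E F G"
      show "countably_covered_by I (G \<inter> S)"
      proof (rule ccontr)
        assume "\<not> ?thesis"
        then obtain y where y: "y \<in> G" "y \<in> B" using cov by blast
        obtain V where V: "openin (vietoris E) V" "V \<inter> F \<noteq> {}" "V \<inter> F \<subseteq> hits E {y}"
          using local[OF y(2)] by metis
        have "hits E {y} \<subseteq> hits E G" using y(1) unfolding hits_def by blast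
        then show False using not_meager_of_open[OF cF V(1,2)] V(3) meag by blast
      qed
    qed
    then have "represents S F" unfolding represents_def using cF F_up by simp
    then show ?thesis by blast
  qed
qed

lemma represents_exists:
  assumes "thick S"
  shows "\<exists>F. represents S F"
proof (cases "\<exists>X. thick X \<and> null_dense X \<and> X \<subseteq> S \<and> X \<noteq> {}")
  case True
  then show ?thesis using represents_with_kernel[OF assms] by blast
next
  case False
  then show ?thesis using represents_without_kernel[OF assms] by blast
qed

section \<open>Reduction to thick sets\<close>

lemma thick_remainder:
  obtains S where "thick S" "countably_covered_by I (topspace E - S)"
proof -
  define J where "J = {k. countably_covered_by I (b k)}"
  define S where "S = topspace E - (\<Union>k\<in>J. b k)"
  have cov: "countably_covered_by I (\<Union>k\<in>J. b k)"
    unfolding J_def by (intro countably_covered_UN) auto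
  have "openin E (\<Union>k\<in>J. b k)" using open_b by blast
  then have "closedin E S" unfolding S_def by blast
  moreover have "\<not> U \<inter> S \<subseteq> K" if U: "openin E U" "U \<inter> S \<noteq> {}" and K: "K \<in> I" for U K
  proof
    assume sub: "U \<inter> S \<subseteq> K"
    obtain x where x: "x \<in> U" "x \<in> S" using U(2) by blast
    obtain k where k: "x \<in> b k" "E closure_of b k \<subseteq> U" by (rule base_point[OF U(1) x(1)])
    \<comment> \<open>The part of \<open>b k\<close> in \<open>S\<close> lies in \<open>K\<close>,
      the rest was deleted and is covered; so \<open>b k\<close> should itself have been
      deleted.\<close>
    have "b k \<subseteq> (\<Union>k\<in>J. b k) \<union> K"
      using sub k(2) b_subset_closure[of k] openin_subset[OF open_b[of k]] unfolding S_def by blast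
    then have "countably_covered_by I (b k)"
      using countably_covered_Un[OF cov countably_covered_member[OF K]] countably_covered_subset by metis
    then show False using x(2) k(1) unfolding S_def J_def by blast
  qed
  ultimately have "thick S" unfolding thick_def by blast
  moreover have "countably_covered_by I (topspace E - S)"
    by (rule countably_covered_subset[OF cov]) (auto simp: S_def)
  ultimately show thesis by (rule that)
qed

text \<open>By Baire category no nonempty open set is meager. Nothing has to be deleted in this
  case, and so the representing family is upward closed in all of \<open>E\<close>.\<close>

lemma thick_topspace:
  assumes "\<And>K. K \<in> I \<Longrightarrow> meager_in E K"
  shows "thick (topspace E)"
  unfolding thick_def
proof (intro conjI allI impI)
  show "closedin E (topspace E)" by simp
  fix U K assume U: "openin E U" "U \<inter> topspace E \<noteq> {}" and K: "K \<in> I"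
  have "meager_in (subtopology E (topspace E)) K" using assms[OF K] by simp
  then obtain \<N> where \<N>: "countable \<N>" "\<forall>N\<in>\<N>. thin_in E (topspace E) N" "K \<subseteq> \<Union>\<N>"
    using meager_in_subtopology_iff[of E "topspace E" K] closedin_subset[OF I_closed[OF K]] by auto
  show "\<not> U \<inter> topspace E \<subseteq> K"
  proof
    assume "U \<inter> topspace E \<subseteq> K"
    then have sub: "U \<inter> topspace E \<subseteq> \<Union>\<N>" using \<N>(3) by blast
    have "closedin E N" if "N \<in> \<N>" for N using \<N>(2) that unfolding thin_in_def by blast
    then obtain N V where "N \<in> \<N>" "openin E V" "V \<inter> topspace E \<noteq> {}" "V \<inter> topspace E \<subseteq> N"
      using Baire_closed_cover[OF compact Hausdorff closedin_topspace U \<N>(1) _ sub] by metis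
    then show False using \<N>(2) unfolding thin_in_def by blast
  qed
qed

end

theorem theorem1p1:
  fixes E :: "'a topology" and I :: "'a set set"
  assumes "polish_in E" and "compact_space E"
    and "compact_ideal E I"
    and "gdelta_in (vietoris E) I"
    and "property_star E I"
  shows "(\<exists>F. compactin (vietoris E) F \<and>
            (\<forall>G. gdelta_in E G \<longrightarrow> (countably_covered_by I G \<longleftrightarrow> hits_meager_in E F G))) \<and>
         ((\<forall>K\<in>I. meager_in E K) \<longrightarrow>
            (\<exists>F. compactin (vietoris E) F \<and> upward_closed E F \<and>
              (\<forall>G. gdelta_in E G \<longrightarrow> (countably_covered_by I G \<longleftrightarrow> hits_meager_in E F G))))"
proof -
  have metr: "metrizable_space E" and sep: "separable_space E"
    using assms(1) completely_metrizable_imp_metrizable_space unfolding polish_in_def by auto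
  obtain b where "compact_base E b"
    using compact_base_exists[OF assms(2) metrizable_imp_Hausdorff_space[OF metr]
      separable_metrizable_imp_second_countable[OF metr sep]] by metis
  then interpret gdelta_ideal E b I
    using assms(3-5) by (simp add: gdelta_ideal_def gdelta_ideal_axioms_def)
  have cpt: "compactin (vietoris E) F" if "closedin (vietoris E) F" for F
    using that compact_space_vietoris[OF compact Hausdorff] closedin_compact_space by blast
  show ?thesis
  proof (intro conjI impI)
    obtain S where S: "thick S" "countably_covered_by I (topspace E - S)" by (rule thick_remainder)
    obtain F where F: "represents S F" using represents_exists[OF S(1)] by blast
    have "countably_covered_by I G \<longleftrightarrow> hits_meager_in E F G" if "gdelta_in E G" for G
    proof -
      \<comment> \<open>The deleted part is countably covered, so only the trace of \<open>G\<close>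
        on \<open>S\<close> decides whether \<open>G\<close> is.\<close>
      have "G \<subseteq> (G \<inter> S) \<union> (topspace E - S)" using gdelta_in_subset[OF that] by blast
      then have "countably_covered_by I G \<longleftrightarrow> countably_covered_by I (G \<inter> S)"
        using countably_covered_Un[OF _ S(2)] countably_covered_subset by (metis inf_le1)
      then show ?thesis using F unfolding represents_def by simp
    qed
    then show "\<exists>F. compactin (vietoris E) F \<and>
        (\<forall>G. gdelta_in E G \<longrightarrow> (countably_covered_by I G \<longleftrightarrow> hits_meager_in E F G))"
      using F cpt unfolding represents_def by blast
  next
    assume "\<forall>K\<in>I. meager_in E K"
    then have "thick (topspace E)" by (intro thick_topspace) blast
    then obtain F where F: "represents (topspace E) F" using represents_exists by blast
    have "upward_closed E F"
      unfolding upward_closed_def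
    proof (intro ballI impI)
      fix K L assume K: "K \<in> F" and L: "L \<in> compacts E" "K \<subseteq> L"
      have "closedin E L" using L(1) compacts_iff by blast
      then show "L \<in> F" using F K L(2) closedin_subset unfolding represents_def by metis
    qed
    moreover have "countably_covered_by I G \<longleftrightarrow> hits_meager_in E F G" if "gdelta_in E G" for G
    proof -
      have "G \<inter> topspace E = G" using gdelta_in_subset[OF that] by blast
      then show ?thesis using F unfolding represents_def by metis
    qed
    ultimately show "\<exists>F. compactin (vietoris E) F \<and> upward_closed E F \<and>
        (\<forall>G. gdelta_in E G \<longrightarrow> (countably_covered_by I G \<longleftrightarrow> hits_meager_in E F G))"
      using F cpt unfolding represents_def by blast
  qed
qed

end
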